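(* Let $S>\tfrac12$, $s>0$, and let $X\in\mathcal H^2_T(\mathbb R^d)$ be $S$-compressible. Suppose in addition that $X\in\mathbb D^{s,2:d}_T$. Then there is a constant $C>0$, depending on $X$ but not on $N$ and $P$, such that for every $N\in\mathbb N_+$ and every $P\in\mathbb N$, $$\inf_{\substack{\mathfrak m^{(1)},\dots,\mathfrak m^{(N)}\in\bigcup_{m=0}^P\mathfrak C_m\\ \beta_1,\dots,\beta_N\in\mathbb R^d}}\Big\|X-\sum_{n=1}^N\beta_n\mathfrak m^{(n)}\Big\|_{\mathcal H^2_T(\mathbb R^d)}\le C\Big(N^{-(S-\frac12)}+(1+P)^{-s/2}\Big).$$
   Context: $\mathbb N=\{0,1,2,\dots\}$, $\mathbb N_+=\{1,2,\dots\}$, $[n]_+=\{1,\dots,n\}$. Fix $T>0$, $D,d\in\mathbb N_+$, and a $D$-dimensional Brownian motion $W$ on a complete probability space, with $(\mathcal F_t)_{0\le t\le T}$ the usual augmentation of its filtration. $\mathcal H^2_T(\mathbb R^d)$ is the Hilbert space of $\mathbb R^d$-valued predictable processes $u$ with $\|u\|^2_{\mathcal H^2_T(\mathbb R^d)}=\mathbb E\int_0^T|u_t|^2\,dt<\infty$; $\mathcal H^2_T:=\mathcal H^2_T(\mathbb R)$. Chaoslets. $h_n=\mathrm{He}_n/\sqrt{n!}$ with $\mathrm{He}_n(x)=(-1)^ne^{x^2/2}\frac{d^n}{dx^n}e^{-x^2/2}$. For $i\in\mathbb N$, $0\le k<2^i$, $$\psi_{i,k}(t)=\tfrac{2^{i/2}}{\sqrt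 T}\Big(-\mathbf 1_{[\frac{Tk}{2^i},\frac{T(1+2k)}{2^{i+1}})}(t)+\mathbf 1_{[\frac{T(1+2k)}{2^{i+1}},\frac{T(k+1)}{2^i})}(t)\Big),$$ and for $r\in[D]_+$, $Z^r_{i,k}=\int_0^T\psi_{i,k}\,dW^r=\frac{2^{i/2}}{\sqrt T}\big(W^r_{Tk/2^i}-2W^r_{T(1+2k)/2^{i+1}}+W^r_{T(k+1)/2^i}\big)$. For $p\in\mathbb N$, $0\le q\le2^p-1$ let $\mathcal I_{p,q}=\{(i,k):0\le k<2^i,\ \frac{k+1}{2^i}\le\frac q{2^p}\}$. For a finitely supported family $\boldsymbol\alpha=(\alpha^r_{i,k})_{(i,k)\in\mathcal I_{p,q},r\in[D]_+}$ in $\mathbb N$, the chaoslet is $$\mathfrak C^{\boldsymbol\alpha}_{(p,q)}(t,\omega)=\psi_{p,q}(t)\prod_{(i,k)\in\mathcal I_{p,q}}\prod_{r=1}^D h_{\alpha^r_{i,k}}(Z^r_{i,k}(\omega)),$$ of degree $|\boldsymbol\alpha|=\sum\alpha^r_{i,k}$. The constant process $1/\sqrt T$ is also a chaoslet, of degree $0$. $\mathfrak C_n$ is the set of chaoslets of degree $n$, $\mathfrak C=\bigcup_n\mathfrak C_n$; this is an orthonormal family in $\mathcal H^2_T$. Malliavin–Sobolev space. $\mathbb D^{s,2}_T=\{X\in\mathcal H^2_T:\sum_{n\ge0}(1+n)^s\|\bar J_nX\|^2_{\mathcal H^2_T}<\infty\}$, where $\bar J_n$ is the orthogonal projection in $\mathcal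 H^2_T$ onto the closed linear span of $\mathfrak C_n$; $\mathbb D^{s,2:d}_T$ is the space of $\mathbb R^d$-valued processes all of whose components lie in $\mathbb D_T^{s,2}$. Compressibility. $X\in\mathcal H^2_T(\mathbb R^d)$ with chaoslet expansion $X=\sum_{k\ge0}\sum_{\mathfrak m\in\mathfrak C_k}\beta_{k,\mathfrak m}\mathfrak m$ (convergence in $\mathcal H^2_T(\mathbb R^d)$, $\beta_{k,\mathfrak m}\in\mathbb R^d$) is $S$-compressible if there is $C_X>0$ such that the non-increasing rearrangement $(\beta^\star_r)_{r\ge1}$ of the family $(|\beta_{k,\mathfrak m}|_{\mathbb R^d})_{k,\mathfrak m}$ satisfies $\beta^\star_r\le C_X r^{-S}$ for all $r\in\mathbb N_+$. *)

theory Defs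
  imports "HOL-Probability.Probability"
begin

section \<open>Brownian motion and predictable processes\<close>

text \<open>
  Processes are curried functions of time and state. Only the times in \<open>{0..T}\<close> and the states in
  \<open>space M\<close> matter. The dimensions are the cardinalities of the finite types \<open>'D\<close> (Brownian motion)
  and \<open>'d\<close> (values of the processes to be approximated).
\<close>

definition brownian_motion :: "'a measure \<Rightarrow> real \<Rightarrow> (real \<Rightarrow> 'a \<Rightarrow> real ^ 'D) \<Rightarrow> bool" where
  "brownian_motion M T W \<longleftrightarrow>
     (\<forall>t\<in>{0..T}. W t \<in> borel_measurable M) \<and>
     (AE \<omega> in M. W 0 \<omega> = 0) \<and>
     (AE \<omega> in M. continuous_on {0..T} (\<lambda>t. W t \<omega>)) \<and>
     (\<forall>(n::nat) \<tau>. (\<forall>i\<le>n. \<tau> i \<in> {0..T}) \<and> (\<forall>i<n. \<tau> i < \<tau> (Suc i)) \<longrightarrow>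
        prob_space.indep_vars M (\<lambda>_. borel) (\<lambda>i \<omega>. W (\<tau> (Suc i)) \<omega> - W (\<tau> i) \<omega>) {..<n}) \<and>
     (\<forall>s t. 0 \<le> s \<and> s < t \<and> t \<le> T \<longrightarrow>
        prob_space.indep_vars M (\<lambda>_. borel) (\<lambda>r \<omega>. (W t \<omega> - W s \<omega>) $ r) UNIV \<and>
        (\<forall>r. distributed M lborel (\<lambda>\<omega>. (W t \<omega> - W s \<omega>) $ r) (normal_density 0 (sqrt (t - s)))))"

definition completed_history :: "'a measure \<Rightarrow> real \<Rightarrow> (real \<Rightarrow> 'a \<Rightarrow> real ^ 'D) \<Rightarrow> real \<Rightarrow> 'a set set" where
  "completed_history M T W s =
     sigma_sets (space M)
       ({W u -` B \<inter> space M | u B. 0 \<le> u \<and> u \<le> s \<and> u \<le> T \<and> B \<in> sets borel} \<union> null_sets M)"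

text \<open>
  The usual augmentation. The history is frozen after time \<open>T\<close>, so for \<open>t = T\<close> the
  intersection is the completed sigma-algebra generated by all of \<open>W\<close>.
\<close>

definition brownian_filtration :: "'a measure \<Rightarrow> real \<Rightarrow> (real \<Rightarrow> 'a \<Rightarrow> real ^ 'D) \<Rightarrow> real \<Rightarrow> 'a measure" where
  "brownian_filtration M T W t = sigma (space M) (\<Inter>s\<in>{t<..}. completed_history M T W s)"

definition predictable_sigma :: "'a measure \<Rightarrow> real \<Rightarrow> (real \<Rightarrow> 'a \<Rightarrow> real ^ 'D) \<Rightarrow> (real \<times> 'a) measure" where
  "predictable_sigma M T W =
     sigma ({0..T} \<times> space M)
       ({{0} \<times> A | A. A \<in> sets (brownian_filtration M T W 0)} \<union>
        {{s<..t} \<times> A | s t A. 0 \<le> s \<and> s < t \<and> t \<le> T \<and> A \<in> sets (brownian_filtration M T W s)})"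


section \<open>The space of square-integrable predictable processes\<close>

definition h2_energy :: "'a measure \<Rightarrow> real \<Rightarrow> (real \<Rightarrow> 'a \<Rightarrow> 'b::real_normed_vector) \<Rightarrow> ennreal" where
  "h2_energy M T u = (\<integral>\<^sup>+\<omega>. (\<integral>\<^sup>+t\<in>{0..T}. ennreal ((norm (u t \<omega>))\<^sup>2) \<partial>lborel) \<partial>M)"

definition H2 :: "'a measure \<Rightarrow> real \<Rightarrow> (real \<Rightarrow> 'a \<Rightarrow> real ^ 'D) \<Rightarrow> (real \<Rightarrow> 'a \<Rightarrow> 'b::euclidean_space) set" where
  "H2 M T W = {u. (\<lambda>(t, \<omega>). u t \<omega>) \<in> borel_measurable (predictable_sigma M T W) \<and> h2_energy M T u < \<infinity>}"

text \<open>
  Elements of \<open>H2\<close> are processes, not equivalence classes, so this is a seminorm. It is meaningful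
  only for processes of finite energy, since \<open>enn2real\<close> maps infinity to 0.
\<close>

definition h2_norm :: "'a measure \<Rightarrow> real \<Rightarrow> (real \<Rightarrow> 'a \<Rightarrow> 'b::real_normed_vector) \<Rightarrow> real" where
  "h2_norm M T u = sqrt (enn2real (h2_energy M T u))"

definition h2_inner :: "'a measure \<Rightarrow> real \<Rightarrow> (real \<Rightarrow> 'a \<Rightarrow> real) \<Rightarrow> (real \<Rightarrow> 'a \<Rightarrow> real) \<Rightarrow> real" where
  "h2_inner M T u v = (LINT \<omega>|M. (LINT t:{0..T}|lborel. u t \<omega> * v t \<omega>))"

definition h2_closed_span ::
  "'a measure \<Rightarrow> real \<Rightarrow> (real \<Rightarrow> 'a \<Rightarrow> real ^ 'D) \<Rightarrow> (real \<Rightarrow> 'a \<Rightarrow> real) set \<Rightarrow> (real \<Rightarrow> 'a \<Rightarrow> real) set" where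
  "h2_closed_span M T W A =
     {u \<in> H2 M T W. \<forall>\<epsilon>>0. \<exists>F c. finite F \<and> F \<subseteq> A \<and>
        h2_norm M T (\<lambda>t \<omega>. u t \<omega> - (\<Sum>m\<in>F. c m * m t \<omega>)) < \<epsilon>}"

text \<open>
  \<open>Y\<close> is (a version of) the orthogonal projection of \<open>X\<close> onto the closed linear span of \<open>A\<close>;
  it is determined by \<open>X\<close> and \<open>A\<close> up to a process of norm 0.
\<close>

definition is_h2_projection ::
  "'a measure \<Rightarrow> real \<Rightarrow> (real \<Rightarrow> 'a \<Rightarrow> real ^ 'D) \<Rightarrow> (real \<Rightarrow> 'a \<Rightarrow> real) set \<Rightarrow>
   (real \<Rightarrow> 'a \<Rightarrow> real) \<Rightarrow> (real \<Rightarrow> 'a \<Rightarrow> real) \<Rightarrow> bool" where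
  "is_h2_projection M T W A X Y \<longleftrightarrow>
     Y \<in> h2_closed_span M T W A \<and>
     (\<forall>v\<in>h2_closed_span M T W A. h2_inner M T (\<lambda>t \<omega>. X t \<omega> - Y t \<omega>) v = 0)"


section \<open>Chaoslets\<close>

definition hermite :: "nat \<Rightarrow> real \<Rightarrow> real" where
  "hermite n x = (-1) ^ n * exp (x\<^sup>2 / 2) * (deriv ^^ n) (\<lambda>y::real. exp (- y\<^sup>2 / 2)) x"

definition normalized_hermite :: "nat \<Rightarrow> real \<Rightarrow> real" where
  "normalized_hermite n x = hermite n x / sqrt (fact n)"

definition haar :: "real \<Rightarrow> nat \<Rightarrow> nat \<Rightarrow> real \<Rightarrow> real" where
  "haar T i k t = 2 powr (real i / 2) / sqrt T *
     (- indicator {T * real k / 2 ^ i ..< T * (1 + 2 * real k) / 2 ^ (i + 1)} t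
      + indicator {T * (1 + 2 * real k) / 2 ^ (i + 1) ..< T * (real k + 1) / 2 ^ i} t)"

text \<open>The Wiener integral of \<open>haar T i k\<close> against the component \<open>r\<close> of \<open>W\<close>.\<close>

definition haar_gaussian :: "real \<Rightarrow> (real \<Rightarrow> 'a \<Rightarrow> real ^ 'D) \<Rightarrow> 'D \<Rightarrow> nat \<Rightarrow> nat \<Rightarrow> 'a \<Rightarrow> real" where
  "haar_gaussian T W r i k \<omega> = 2 powr (real i / 2) / sqrt T *
     (W (T * real k / 2 ^ i) \<omega> $ r
      - 2 * (W (T * (1 + 2 * real k) / 2 ^ (i + 1)) \<omega> $ r)
      + W (T * (real k + 1) / 2 ^ i) \<omega> $ r)"

definition past_indices :: "nat \<Rightarrow> nat \<Rightarrow> (nat \<times> nat) set" where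
  "past_indices p q = {(i, k). k < 2 ^ i \<and> (real k + 1) / 2 ^ i \<le> real q / 2 ^ p}"

definition mi_support :: "((nat \<times> nat) \<times> 'D \<Rightarrow> nat) \<Rightarrow> ((nat \<times> nat) \<times> 'D) set" where
  "mi_support \<alpha> = {x. \<alpha> x \<noteq> 0}"

definition multi_indices :: "nat \<Rightarrow> nat \<Rightarrow> ((nat \<times> nat) \<times> 'D \<Rightarrow> nat) set" where
  "multi_indices p q = {\<alpha>. finite (mi_support \<alpha>) \<and> mi_support \<alpha> \<subseteq> past_indices p q \<times> UNIV}"

definition mi_degree :: "((nat \<times> nat) \<times> 'D \<Rightarrow> nat) \<Rightarrow> nat" where
  "mi_degree \<alpha> = (\<Sum>x\<in>mi_support \<alpha>. \<alpha> x)"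

text \<open>
  The product is written over the finite support of \<open>\<alpha>\<close>: the remaining factors are
  \<open>normalized_hermite 0 = 1\<close>, and a product over an infinite set would be 1 by convention.
\<close>

definition chaoslet ::
  "real \<Rightarrow> (real \<Rightarrow> 'a \<Rightarrow> real ^ 'D) \<Rightarrow> nat \<Rightarrow> nat \<Rightarrow> ((nat \<times> nat) \<times> 'D \<Rightarrow> nat) \<Rightarrow> real \<Rightarrow> 'a \<Rightarrow> real" where
  "chaoslet T W p q \<alpha> t \<omega> =
     haar T p q t *
     (\<Prod>((i, k), r)\<in>mi_support \<alpha>. normalized_hermite (\<alpha> ((i, k), r)) (haar_gaussian T W r i k \<omega>))"

definition chaoslets :: "real \<Rightarrow> (real \<Rightarrow> 'a \<Rightarrow> real ^ 'D) \<Rightarrow> nat \<Rightarrow> (real \<Rightarrow> 'a \<Rightarrow> real) set" where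
  "chaoslets T W n =
     {chaoslet T W p q \<alpha> | p q \<alpha>. q < 2 ^ p \<and> \<alpha> \<in> multi_indices p q \<and> mi_degree \<alpha> = n} \<union>
     (if n = 0 then {\<lambda>t \<omega>. 1 / sqrt T} else {})"


section \<open>Malliavin-Sobolev spaces and compressibility\<close>

definition malliavin_sobolev ::
  "'a measure \<Rightarrow> real \<Rightarrow> (real \<Rightarrow> 'a \<Rightarrow> real ^ 'D) \<Rightarrow> real \<Rightarrow> (real \<Rightarrow> 'a \<Rightarrow> real) set" where
  "malliavin_sobolev M T W s =
     {X \<in> H2 M T W. \<exists>J :: nat \<Rightarrow> real \<Rightarrow> 'a \<Rightarrow> real.
        (\<forall>n. is_h2_projection M T W (chaoslets T W n) X (J n)) \<and>
        summable (\<lambda>n. (1 + real n) powr s * (h2_norm M T (J n))\<^sup>2)}"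

definition malliavin_sobolev_vec ::
  "'a measure \<Rightarrow> real \<Rightarrow> (real \<Rightarrow> 'a \<Rightarrow> real ^ 'D) \<Rightarrow> real \<Rightarrow> (real \<Rightarrow> 'a \<Rightarrow> real ^ 'd) set" where
  "malliavin_sobolev_vec M T W s = {X. \<forall>j. (\<lambda>t \<omega>. X t \<omega> $ j) \<in> malliavin_sobolev M T W s}"

text \<open>
  Unconditional convergence: the finite partial sums converge along the directed set of finite
  subsets of the index set, the filter underlying \<^const>\<open>HAS_SUM\<close>.
\<close>

definition has_chaoslet_expansion ::
  "'a measure \<Rightarrow> real \<Rightarrow> (real \<Rightarrow> 'a \<Rightarrow> real ^ 'D) \<Rightarrow> (real \<Rightarrow> 'a \<Rightarrow> real ^ 'd) \<Rightarrow>
   (nat \<times> (real \<Rightarrow> 'a \<Rightarrow> real) \<Rightarrow> real ^ 'd) \<Rightarrow> bool" where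
  "has_chaoslet_expansion M T W X \<beta> \<longleftrightarrow>
     ((\<lambda>F. h2_norm M T (\<lambda>t \<omega>. X t \<omega> - (\<Sum>(k, m)\<in>F. m t \<omega> *\<^sub>R \<beta> (k, m)))) \<longlongrightarrow> 0)
       (finite_subsets_at_top (SIGMA k:UNIV. chaoslets T W k))"

text \<open>
  \<open>b 1, b 2, \<dots>\<close> lists the family \<open>a\<close> over \<open>I\<close> in non-increasing order. Zero members may be
  left out, as they must be when infinitely many members are positive.
\<close>

definition is_nonincreasing_rearrangement :: "(nat \<Rightarrow> real) \<Rightarrow> ('i \<Rightarrow> real) \<Rightarrow> 'i set \<Rightarrow> bool" where
  "is_nonincreasing_rearrangement b a I \<longleftrightarrow>
     (\<forall>r r'. 1 \<le> r \<and> r \<le> r' \<longrightarrow> b r' \<le> b r) \<and>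
     (\<exists>\<sigma>. inj_on \<sigma> {1..} \<and> \<sigma> ` {1..} \<subseteq> I \<and> (\<forall>r\<ge>1. b r = a (\<sigma> r)) \<and>
        (\<forall>x\<in>I - \<sigma> ` {1..}. a x = 0))"

definition compressible ::
  "'a measure \<Rightarrow> real \<Rightarrow> (real \<Rightarrow> 'a \<Rightarrow> real ^ 'D) \<Rightarrow> real \<Rightarrow> (real \<Rightarrow> 'a \<Rightarrow> real ^ 'd) \<Rightarrow> bool" where
  "compressible M T W S X \<longleftrightarrow>
     X \<in> H2 M T W \<and>
     (\<exists>\<beta> b. has_chaoslet_expansion M T W X \<beta> \<and>
        is_nonincreasing_rearrangement b (\<lambda>x. norm (\<beta> x)) (SIGMA k:UNIV. chaoslets T W k) \<and>
        (\<exists>C>0. \<forall>r\<ge>1. b r \<le> C * real r powr (- S)))"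

end

theory Submission
  imports Defs
begin

text \<open>
  Keep, among the \<open>N\<close> largest coefficients of \<open>X\<close>, those of degree at most \<open>P\<close>. Since the chaoslets
  are orthonormal, the squared error is at most a constant times the sum of the squared coefficients
  left out. Those beyond the \<open>N\<close> largest contribute \<open>\<Sum>r>N. r powr (- 2 * S)\<close>, of order
  \<open>N powr (1 - 2 * S)\<close>. Those of degree \<open>k > P\<close> contribute at most the squared norm of the
  projection on degree \<open>k\<close> by Bessel's inequality, and the Sobolev weights sum these up to
  order \<open>(1 + P) powr (- s)\<close>.

  Orthonormality reduces, time and randomness being independent, to that of the Haar functions and
  of products of Hermite polynomials in the Haar coefficients of white noise. On a fine dyadic grid
  the latter are orthonormal combinations of i.i.d. standard normal increments, to
  which Gaussian integration by parts applies.
\<close>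

section \<open>Haar functions on a dyadic grid\<close>

text \<open>The two hypotheses on \<open>X\<close> speak of different objects: coefficients of an
  expansion, and projections on degrees. They meet in the inner products with chaoslets. Norm
  convergence forces the coefficients of an expansion to be these inner products, and a projection
  on degree \<open>k\<close> shares them, for the chaoslets of that degree, with the component of
  \<open>X\<close> that it projects. The latter is the delicate point: closed spans consist of
  predictable processes, so a chaoslet has to be traded for an equivalent predictable process before
  orthogonality can be tested. Norms and inner products are computed on the product of
  \<open>M\<close> and \<open>{0..T}\<close>, where predictability is weakened to joint
  measurability. Orthonormality concerns two chaoslets at a time. Hence a grid level that resolves
  two multi-indices is enough, and only finitely many Gaussian variables ever occur together. An
  index is dropped because of its rank or because of its degree. The two sums are bounded
  separately, and the square root of their total halves both exponents.\<close>

lemma sum_indicator_block: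
  fixes f :: "nat \<Rightarrow> real"
  assumes "b \<le> n"
  shows "(\<Sum>j<n. indicator {a..<b} j * f j) = (\<Sum>j\<in>{a..<b}. f j)"
  using assms by (intro sum.mono_neutral_cong_right) (auto simp: indicator_def)

text \<open>The sign pattern of a Haar function on the cells of a grid. At resolution
  \<open>L\<close>, each half of the support of a level \<open>i\<close> function consists of
  \<open>2 ^ h\<close> cells with \<open>h = L - Suc i\<close>, and \<open>j div 2 ^ h\<close>
  numbers the half that contains cell \<open>j\<close>. With integer division, nesting of supports
  becomes arithmetic.\<close>

definition haar_sign :: "nat \<Rightarrow> nat \<Rightarrow> nat \<Rightarrow> real" where
  "haar_sign h k j = (if j div 2 ^ h = 2 * k then - 1 else if j div 2 ^ h = 2 * k + 1 then 1 else 0)"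

lemma div_pow_eq_iff: "j div 2 ^ h = c \<longleftrightarrow> j \<in> {c * 2 ^ h..<(c + 1) * 2 ^ h}" for j h c :: nat
proof -
  have "j div 2 ^ h = c \<longleftrightarrow> c \<le> j div 2 ^ h \<and> j div 2 ^ h < c + 1" by auto
  also have "\<dots> \<longleftrightarrow> c * 2 ^ h \<le> j \<and> j < (c + 1) * 2 ^ h"
    by (simp add: less_eq_div_iff_mult_less_eq div_less_iff_less_mult del: add_mult_distrib)
  finally show ?thesis by simp
qed

lemma haar_sign_eq_indicator:
  "haar_sign h k j = - indicator {2 * k * 2 ^ h..<(2 * k + 1) * 2 ^ h} j
     + indicator {(2 * k + 1) * 2 ^ h..<(2 * k + 2) * 2 ^ h} j"
  unfolding haar_sign_def using div_pow_eq_iff[of j h "2 * k"] div_pow_eq_iff[of j h "2 * k + 1"]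
  by (auto simp: indicator_def)

lemma block_le:
  assumes "k < 2 ^ i" "Suc (i + h) = L"
  shows "(2 * k + 2) * 2 ^ h \<le> (2::nat) ^ L"
proof -
  have "(2 * k + 2) * 2 ^ h = (k + 1) * 2 ^ Suc h" by simp
  also have "\<dots> \<le> 2 ^ i * 2 ^ Suc h" using assms(1) by (intro mult_right_mono) auto
  also have "\<dots> = 2 ^ L" using assms(2) by (metis add_Suc_right power_add)
  finally show ?thesis .
qed

lemma sum_haar_sign:
  assumes "k < 2 ^ i" "Suc (i + h) = L"
  shows "(\<Sum>j<2 ^ L. haar_sign h k j) = 0"
proof -
  have le: "(2 * k + 2) * 2 ^ h \<le> (2::nat) ^ L" "(2 * k + 1) * 2 ^ h \<le> (2::nat) ^ L"
    using block_le[OF assms] by (auto simp: algebra_simps)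
  show ?thesis
    unfolding haar_sign_eq_indicator sum.distrib sum_negf
    using sum_indicator_block[OF le(1), of "(2 * k + 1) * 2 ^ h" "\<lambda>_. 1"]
      sum_indicator_block[OF le(2), of "2 * k * 2 ^ h" "\<lambda>_. 1"]
    by (simp add: algebra_simps)
qed

text \<open>The support of the finer pattern is one dyadic block of \<open>2 ^ Suc h'\<close> cells.
  Since \<open>Suc h' \<le> h\<close>, this block lies within a single half-block of the coarser
  pattern, which is therefore constant there; \<open>k' * 2 ^ Suc h'\<close> is the first cell of
  the block.\<close>

lemma haar_sign_nested:
  assumes "h' < h" "haar_sign h' k' j \<noteq> 0"
  shows "haar_sign h k j = haar_sign h k (k' * 2 ^ Suc h')"
proof -
  have "j div 2 ^ h' div 2 = k'"
    using assms(2) by (auto simp: haar_sign_def split: if_splits)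
  hence k': "j div 2 ^ Suc h' = k'"
    by (metis div_mult2_eq mult.commute power_Suc)
  have h: "(2::nat) ^ h = 2 ^ Suc h' * 2 ^ (h - Suc h')"
    using assms(1) by (simp flip: power_add del: power_Suc)
  have "j div 2 ^ h = (k' * 2 ^ Suc h') div 2 ^ h"
    unfolding h div_mult2_eq k' by simp
  thus ?thesis by (simp add: haar_sign_def)
qed

text \<open>The coarser factor is constant on the support of the finer one, whose signs
  cancel.\<close>

lemma sum_haar_sign_mult_less:
  assumes "k' < 2 ^ i'" "Suc (i' + h') = L" "h' < h"
  shows "(\<Sum>j<2 ^ L. haar_sign h k j * haar_sign h' k' j) = 0"
proof -
  have "haar_sign h k j * haar_sign h' k' j = haar_sign h k (k' * 2 ^ Suc h') * haar_sign h' k' j" for j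
    using haar_sign_nested[OF assms(3), of k' j k] by (cases "haar_sign h' k' j = 0") auto
  hence "(\<Sum>j<2 ^ L. haar_sign h k j * haar_sign h' k' j) =
      (\<Sum>j<2 ^ L. haar_sign h k (k' * 2 ^ Suc h') * haar_sign h' k' j)"
    by (intro sum.cong) auto
  also have "\<dots> = 0" by (simp add: sum_distrib_left[symmetric] sum_haar_sign[OF assms(1,2)])
  finally show ?thesis .
qed

lemma sum_haar_sign_same:
  assumes "k < 2 ^ i" "Suc (i + h) = L"
  shows "(\<Sum>j<2 ^ L. haar_sign h k j * haar_sign h k' j) = (if k = k' then 2 ^ Suc h else 0)"
proof (cases "k = k'")
  case True
  have eq: "haar_sign h k j * haar_sign h k j = indicator {2 * k * 2 ^ h..<(2 * k + 2) * 2 ^ h} j" for j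
    unfolding haar_sign_eq_indicator by (auto simp: indicator_def algebra_simps)
  show ?thesis
    unfolding eq True[symmetric]
    using sum_indicator_block[OF block_le[OF assms], of "2 * k * 2 ^ h" "\<lambda>_. 1"] by simp
next
  case False
  \<comment> \<open>A half-block determines its \<open>k\<close>, so different \<open>k\<close> at
    one level have disjoint supports.\<close>
  have "c \<noteq> 2 * k' \<and> c \<noteq> 2 * k' + 1" if "c = 2 * k \<or> c = 2 * k + 1" for c
    using that False by presburger
  hence "haar_sign h k j * haar_sign h k' j = 0" for j
    unfolding haar_sign_def by (cases "j div 2 ^ h = 2 * k \<or> j div 2 ^ h = 2 * k + 1") auto
  thus ?thesis using False by (simp add: sum.neutral del: mult_eq_0_iff)
qed

text \<open>Coordinates of a Haar function in the orthonormal functions \<open>cell\<close>, and at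
  the same time of its Wiener integral in the normalized increments. The prefactor is the ratio of
  the heights of the Haar function and of a cell.\<close>

definition haar_coeff :: "nat \<Rightarrow> nat \<Rightarrow> nat \<Rightarrow> nat \<Rightarrow> real" where
  "haar_coeff L i k j = sqrt (2 ^ i) / sqrt (2 ^ L) * haar_sign (L - Suc i) k j"

lemma sum_haar_coeff:
  assumes "k < 2 ^ i" "i < L"
  shows "(\<Sum>j<2 ^ L. haar_coeff L i k j) = 0"
  unfolding haar_coeff_def sum_distrib_left[symmetric]
  using sum_haar_sign[OF assms(1), of "L - Suc i" L] assms(2) by simp

lemma haar_coeff_orthonormal:
  assumes "k < 2 ^ i" "i < L" "k' < 2 ^ i'" "i' < L"
  shows "(\<Sum>j<2 ^ L. haar_coeff L i k j * haar_coeff L i' k' j) = (if (i, k) = (i', k') then 1 else 0)"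
proof -
  let ?h = "L - Suc i" and ?h' = "L - Suc i'"
  have L: "Suc (i + ?h) = L" "Suc (i' + ?h') = L" using assms by auto
  have eq: "(\<Sum>j<2 ^ L. haar_coeff L i k j * haar_coeff L i' k' j) =
      sqrt (2 ^ i) * sqrt (2 ^ i') / 2 ^ L * (\<Sum>j<2 ^ L. haar_sign ?h k j * haar_sign ?h' k' j)"
    unfolding haar_coeff_def sum_distrib_left by (intro sum.cong) (auto simp: field_simps)
  consider "?h' < ?h" | "?h < ?h'" | "i = i'" using assms by linarith
  thus ?thesis
  proof cases
    case 1
    thus ?thesis using eq sum_haar_sign_mult_less[OF assms(3) L(2) 1] by auto
  next
    case 2
    thus ?thesis using eq sum_haar_sign_mult_less[OF assms(1) L(1) 2, of k'] by (auto simp: mult.commute)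
  next
    case 3
    \<comment> \<open>The \<open>2 ^ Suc ?h\<close> cells of the support cancel the normalization
      \<open>2 ^ i / 2 ^ L\<close>.\<close>
    have "(2::real) ^ L = 2 ^ i * 2 ^ Suc ?h" using L(1) by (metis add_Suc_right power_add)
    thus ?thesis using 3 eq sum_haar_sign_same[OF assms(1) L(1), of k'] by auto
  qed
qed

section \<open>Haar functions and their Wiener integrals in terms of grid cells\<close>

definition grid :: "real \<Rightarrow> nat \<Rightarrow> nat \<Rightarrow> real" where
  "grid T L j = T * real j / 2 ^ L"

lemma haar_grid_points:
  assumes "i < L"
  shows "T * real k / 2 ^ i = grid T L (2 * k * 2 ^ (L - Suc i))"
    "T * (1 + 2 * real k) / 2 ^ (i + 1) = grid T L ((2 * k + 1) * 2 ^ (L - Suc i))"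
    "T * (real k + 1) / 2 ^ i = grid T L ((2 * k + 2) * 2 ^ (L - Suc i))"
proof -
  have "(2::real) ^ L = 2 ^ i * 2 ^ (L - Suc i) * 2"
    using assms by (simp flip: power_add power_Suc2)
  thus "T * real k / 2 ^ i = grid T L (2 * k * 2 ^ (L - Suc i))"
    "T * (1 + 2 * real k) / 2 ^ (i + 1) = grid T L ((2 * k + 1) * 2 ^ (L - Suc i))"
    "T * (real k + 1) / 2 ^ i = grid T L ((2 * k + 2) * 2 ^ (L - Suc i))"
    unfolding grid_def by (simp_all add: field_simps)
qed

lemma two_powr_half: "2 powr (real i / 2) = sqrt (2 ^ i)"
  by (simp add: powr_half_sqrt_powr powr_realpow)



text \<open>Both the Haar function (with \<open>g\<close> the indicator of a half-line) and its Wiener integral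
  (with \<open>g\<close> a Brownian path) are second differences of a function along the grid.\<close>

lemma haar_second_difference:
  fixes g :: "nat \<Rightarrow> real"
  assumes "k < 2 ^ i" "i < L"
  defines "h \<equiv> L - Suc i"
  shows "g (2 * k * 2 ^ h) - 2 * g ((2 * k + 1) * 2 ^ h) + g ((2 * k + 2) * 2 ^ h) =
    (\<Sum>j<2 ^ L. haar_sign h k j * (g (Suc j) - g j))"
proof -
  have le: "(2 * k + 2) * 2 ^ h \<le> (2::nat) ^ L" "(2 * k + 1) * 2 ^ h \<le> (2::nat) ^ L"
    using block_le[OF assms(1), of h L] assms(2) by (auto simp: h_def algebra_simps)
  have "(\<Sum>j<2 ^ L. haar_sign h k j * (g (Suc j) - g j)) =
      - (\<Sum>j\<in>{2 * k * 2 ^ h..<(2 * k + 1) * 2 ^ h}. g (Suc j) - g j)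
      + (\<Sum>j\<in>{(2 * k + 1) * 2 ^ h..<(2 * k + 2) * 2 ^ h}. g (Suc j) - g j)"
    by (simp only: haar_sign_eq_indicator distrib_right[of "- _"] minus_mult_left[symmetric] sum.distrib
        sum_negf sum_indicator_block[OF le(1)] sum_indicator_block[OF le(2)])
  also have "\<dots> = - (g ((2 * k + 1) * 2 ^ h) - g (2 * k * 2 ^ h))
      + (g ((2 * k + 2) * 2 ^ h) - g ((2 * k + 1) * 2 ^ h))"
    by (subst (1 2) sum_Suc_diff') (auto simp: algebra_simps)
  finally show ?thesis by simp
qed

text \<open>The height gives each cell norm 1 in L2, as its length is
  \<open>T / 2 ^ L\<close>.\<close>

definition cell :: "real \<Rightarrow> nat \<Rightarrow> nat \<Rightarrow> real \<Rightarrow> real" where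
  "cell T L j t = sqrt (2 ^ L) / sqrt T * indicator {grid T L j..<grid T L (Suc j)} t"

lemma grid_mono: "T > 0 \<Longrightarrow> i \<le> j \<Longrightarrow> grid T L i \<le> grid T L j"
  by (simp add: grid_def divide_right_mono)

lemma grid_mem: "T > 0 \<Longrightarrow> j \<le> 2 ^ L \<Longrightarrow> grid T L j \<in> {0..T}"
  by (auto simp: grid_def field_simps mult_left_mono)

lemma indicator_Ico_eq_diff:
  fixes a b t :: real
  assumes "a \<le> b"
  shows "indicator {a..<b} t = (indicator {a..} t - indicator {b..} t :: real)"
  using assms by (auto simp: indicator_def)

lemma haar_eq_sum_cell:
  assumes "T > 0" "k < 2 ^ i" "i < L"
  shows "haar T i k t = (\<Sum>j<2 ^ L. haar_coeff L i k j * cell T L j t)"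
proof -
  define h where "h = L - Suc i"
  \<comment> \<open>With this sign \<open>g b - g a\<close> is the indicator of
    \<open>{grid T L a..<grid T L b}\<close>, so the second difference is minus the first half plus
    the second half, as in \<open>haar\<close>.\<close>
  define g where "g j = (- indicator {grid T L j..} t :: real)" for j
  have ind: "indicator {grid T L a..<grid T L b} t = g b - g a" if "a \<le> b" for a b
    using grid_mono[OF assms(1) that] by (simp add: g_def indicator_Ico_eq_diff)
  have "haar T i k t = sqrt (2 ^ i) / sqrt T *
      (g (2 * k * 2 ^ h) - 2 * g ((2 * k + 1) * 2 ^ h) + g ((2 * k + 2) * 2 ^ h))"
    unfolding haar_def two_powr_half haar_grid_points[OF assms(3)] h_def
    by (subst (1 2) ind) auto
  also have "\<dots> = sqrt (2 ^ i) / sqrt T * (\<Sum>j<2 ^ L. haar_sign h k j * (g (Suc j) - g j))"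
    unfolding h_def by (subst haar_second_difference[OF assms(2,3)]) simp
  also have "\<dots> = (\<Sum>j<2 ^ L. haar_coeff L i k j * cell T L j t)"
    unfolding sum_distrib_left haar_coeff_def cell_def h_def
    by (intro sum.cong) (auto simp: ind)
  finally show ?thesis .
qed

text \<open>Scaled to variance 1. The factor is the same as in \<open>cell\<close>, which is why
  \<open>haar_coeff\<close> serves both.\<close>

definition increment :: "real \<Rightarrow> (real \<Rightarrow> 'a \<Rightarrow> real ^ 'D) \<Rightarrow> nat \<Rightarrow> nat \<times> 'D \<Rightarrow> 'a \<Rightarrow> real" where
  "increment T W L = (\<lambda>(j, r) \<omega>. sqrt (2 ^ L) / sqrt T * (W (grid T L (Suc j)) \<omega> - W (grid T L j) \<omega>) $ r)"

lemma haar_gaussian_eq_sum_increment: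
  assumes "k < 2 ^ i" "i < L"
  shows "haar_gaussian T W r i k \<omega> = (\<Sum>j<2 ^ L. haar_coeff L i k j * increment T W L (j, r) \<omega>)"
  unfolding haar_gaussian_def haar_grid_points[OF assms(2)] two_powr_half
  by (subst haar_second_difference[OF assms, of "\<lambda>j. W (grid T L j) \<omega> $ r"])
    (auto simp: sum_distrib_left haar_coeff_def increment_def intro!: sum.cong)

lemma integral_cell_mult:
  assumes "T > 0"
  shows "(LINT t|lborel. cell T L j t * cell T L l t) = (if j = l then 1 else 0)"
proof (cases "j = l")
  case True
  have "cell T L j t * cell T L j t = 2 ^ L / T * indicator {grid T L j..<grid T L (Suc j)} t" for t
    using assms by (auto simp: cell_def indicator_def)
  hence "(LINT t|lborel. cell T L j t * cell T L j t) = 2 ^ L / T * (grid T L (Suc j) - grid T L j)"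
    using grid_mono[OF assms, of j "Suc j" L] by simp
  also have "\<dots> = 1" using assms by (simp add: grid_def field_simps)
  finally show ?thesis using True by simp
next
  case False
  have "grid T L (Suc l) \<le> grid T L j \<or> grid T L (Suc j) \<le> grid T L l"
    using False grid_mono[OF assms, of "Suc l" j L] grid_mono[OF assms, of "Suc j" l L] by linarith
  hence "(\<lambda>t. cell T L j t * cell T L l t) = (\<lambda>t. 0)"
    by (auto simp: cell_def indicator_def fun_eq_iff)
  thus ?thesis using False by simp
qed

lemma cell_measurable [measurable]: "cell T L j \<in> borel_measurable borel"
  unfolding cell_def by measurable

lemma integrable_cell: "integrable lborel (cell T L j)"
  unfolding cell_def
  by (intro integrable_mult_right integrable_real_indicator)
    (auto intro: emeasure_bounded_finite simp flip: infinity_ennreal_def)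

lemma integrable_cell_mult: "integrable lborel (\<lambda>t. cell T L j t * cell T L l t)"
  by (rule Bochner_Integration.integrable_bound[OF integrable_mult_right[OF integrable_cell[of T L j], of "sqrt (2 ^ L) / sqrt T"]])
    (auto simp: cell_def indicator_def abs_mult)

lemma integrable_haar_mult:
  assumes "T > 0" "k < 2 ^ i" "k' < 2 ^ i'"
  shows "integrable lborel (\<lambda>t. haar T i k t * haar T i' k' t)"
proof -
  define L where "L = Suc (i + i')"
  have "i < L" "i' < L" by (auto simp: L_def)
  show ?thesis
    unfolding haar_eq_sum_cell[OF assms(1,2) \<open>i < L\<close>] haar_eq_sum_cell[OF assms(1,3) \<open>i' < L\<close>] sum_product
    by (intro Bochner_Integration.integrable_sum)
      (simp add: mult.assoc mult.left_commute[of "cell T L _ _"] integrable_cell_mult)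
qed

lemma haar_orthonormal:
  assumes "T > 0" "k < 2 ^ i" "k' < 2 ^ i'"
  shows "(LINT t|lborel. haar T i k t * haar T i' k' t) = (if (i, k) = (i', k') then 1 else 0)"
proof -
  define L where "L = Suc (i + i')"
  have L: "i < L" "i' < L" by (auto simp: L_def)
  have "(LINT t|lborel. haar T i k t * haar T i' k' t) =
      (LINT t|lborel. (\<Sum>j<2 ^ L. \<Sum>l<2 ^ L. haar_coeff L i k j * haar_coeff L i' k' l * (cell T L j t * cell T L l t)))"
    unfolding haar_eq_sum_cell[OF assms(1,2) L(1)] haar_eq_sum_cell[OF assms(1,3) L(2)] sum_product
    by (simp add: mult_ac)
  also have "\<dots> = (\<Sum>j<2 ^ L. \<Sum>l<2 ^ L. haar_coeff L i k j * haar_coeff L i' k' l * (if j = l then 1 else 0))"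
    by (simp add: Bochner_Integration.integral_sum integrable_cell_mult integral_cell_mult[OF assms(1)]
        integrable_mult_right Bochner_Integration.integrable_sum)
  also have "\<dots> = (\<Sum>j<2 ^ L. haar_coeff L i k j * haar_coeff L i' k' j)"
    by (intro sum.cong) (auto simp: if_distrib sum.delta' cong: if_cong)
  finally show ?thesis using haar_coeff_orthonormal[OF assms(2) L(1) assms(3) L(2)] by simp
qed

lemma
  assumes "T > 0" "k < 2 ^ i"
  shows integrable_haar: "integrable lborel (haar T i k)"
    and integral_haar: "(LINT t|lborel. haar T i k t) = 0"
proof -
  note eq = haar_eq_sum_cell[OF assms, of "Suc i"]
  \<comment> \<open>All cells have the same integral. Written by means of the first cell, it no
    longer depends on \<open>j\<close> and can be pulled out of the sum over \<open>j\<close>, which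
    then vanishes by \<open>sum_haar_coeff\<close>.\<close>
  have cell: "(LINT t|lborel. cell T (Suc i) j t) =
      sqrt (2 ^ Suc i) / sqrt T * (grid T (Suc i) 1 - grid T (Suc i) 0)" for j
    using grid_mono[OF assms(1), of j "Suc j" "Suc i"]
    by (simp add: cell_def) (simp add: grid_def field_simps)
  show "integrable lborel (haar T i k)"
    by (subst ext[OF eq]) (auto intro!: Bochner_Integration.integrable_sum integrable_cell)
  have "(LINT t|lborel. haar T i k t) = (\<Sum>j<2 ^ Suc i. haar_coeff (Suc i) i k j) *
      (sqrt (2 ^ Suc i) / sqrt T * (grid T (Suc i) 1 - grid T (Suc i) 0))"
    by (subst ext[OF eq]) (auto simp: Bochner_Integration.integral_sum integrable_cell cell sum_distrib_right
        simp flip: sum_divide_distrib)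
  thus "(LINT t|lborel. haar T i k t) = 0" using sum_haar_coeff[OF assms(2), of "Suc i"] by simp
qed

section \<open>Hermite polynomials\<close>

text \<open>The recursion is what differentiating \<open>He_n\<close> times the Gaussian weight
  produces. Having an object of type \<open>poly\<close> makes \<open>pderiv\<close> available for
  integration by parts.\<close>

fun hermite_poly :: "nat \<Rightarrow> real poly" where
  "hermite_poly 0 = 1"
| "hermite_poly (Suc n) = [:0, 1:] * hermite_poly n - pderiv (hermite_poly n)"

lemma funpow_deriv_gauss:
  "(deriv ^^ n) (\<lambda>y::real. exp (- y\<^sup>2 / 2)) = (\<lambda>x. (-1) ^ n * poly (hermite_poly n) x * exp (- x\<^sup>2 / 2))"
proof (induction n)
  case (Suc n)
  have "((\<lambda>x. (-1) ^ n * poly (hermite_poly n) x * exp (- x\<^sup>2 / 2)) has_real_derivative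
      (-1) ^ Suc n * poly (hermite_poly (Suc n)) x * exp (- x\<^sup>2 / 2)) (at x)" for x
    by (auto intro!: derivative_eq_intros simp: algebra_simps)
  hence "deriv (\<lambda>x. (-1) ^ n * poly (hermite_poly n) x * exp (- x\<^sup>2 / 2)) =
      (\<lambda>x. (-1) ^ Suc n * poly (hermite_poly (Suc n)) x * exp (- x\<^sup>2 / 2))"
    by (intro ext DERIV_imp_deriv)
  thus ?case by (simp only: funpow.simps o_apply Suc)
qed simp

lemma hermite_eq_poly: "hermite n x = poly (hermite_poly n) x"
proof -
  have "(-1::real) ^ n * (-1) ^ n = 1" by (simp flip: power_mult_distrib)
  moreover have "exp (x\<^sup>2 / 2) * exp (- x\<^sup>2 / 2) = 1" by (simp flip: exp_add)
  ultimately show ?thesis unfolding hermite_def funpow_deriv_gauss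
    by (metis (no_types, lifting) mult.assoc mult.commute mult.right_neutral)
qed

text \<open>Differentiate the recursion: the induction hypothesis turns the two derivative terms
  into \<open>Suc n\<close> copies of the recursion for \<open>hermite_poly (Suc n)\<close>, and the
  product rule adds one more. This is how integration by parts will lower both degrees of a product
  at once.\<close>

lemma pderiv_hermite_poly: "pderiv (hermite_poly (Suc n)) = smult (real (Suc n)) (hermite_poly n)"
proof (induction n)
  case (Suc n)
  have "pderiv (hermite_poly (Suc (Suc n))) = hermite_poly (Suc n) +
      [:0, 1:] * pderiv (hermite_poly (Suc n)) - pderiv (pderiv (hermite_poly (Suc n)))"
    by (simp add: hermite_poly.simps(2)[of "Suc n"] pderiv_diff pderiv_mult pderiv_pCons del: hermite_poly.simps)
  also have "\<dots> = hermite_poly (Suc n) + smult (real (Suc n)) ([:0, 1:] * hermite_poly n - pderiv (hermite_poly n))"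
    unfolding Suc pderiv_smult by (simp add: smult_diff_right smult_add_right)
  also have "\<dots> = smult (real (Suc (Suc n))) (hermite_poly (Suc n))"
    unfolding hermite_poly.simps(2)[symmetric]
    by (rule poly_eqI) (simp add: algebra_simps del: hermite_poly.simps)
  finally show ?case .
qed (simp add: pderiv_pCons one_pCons)

section \<open>Gaussian integration by parts\<close>

definition gauss :: "real measure" where
  "gauss = density lborel std_normal_density"

lemma prob_space_gauss: "prob_space gauss"
  unfolding gauss_def by (rule prob_space_normal_density) simp

lemma sets_gauss [measurable_cong, simp]: "sets gauss = sets borel"
  by (simp add: gauss_def)

lemma space_gauss [simp]: "space gauss = UNIV"
  by (simp add: gauss_def)

lemma integrable_gauss_abs_power: "integrable gauss (\<lambda>x. \<bar>x\<bar> ^ k)"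
  unfolding gauss_def using integrable_std_normal_moment_abs[of k]
  by (subst integrable_real_density) auto

lemma integrable_gauss_power: "integrable gauss (\<lambda>x. x ^ k)"
  unfolding gauss_def using integrable_std_normal_moment[of k]
  by (subst integrable_real_density) auto

lemma integral_gauss: "f \<in> borel_measurable borel \<Longrightarrow>
    integral\<^sup>L gauss f = (LINT x|lborel. std_normal_density x * f x)"
  unfolding gauss_def by (subst integral_real_density) auto

text \<open>Integration by parts for monomials, read off from the explicit moments. For even
  \<open>k\<close> the moments are odd and vanish; the truncated \<open>k - 1\<close> at
  \<open>k = 0\<close> is harmless because of the factor \<open>real k\<close>.\<close>

lemma gauss_moment_rec: "(LINT x|gauss. x ^ Suc k) = real k * (LINT x|gauss. x ^ (k - 1))"
proof (cases "even k")
  case True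
  then obtain m where m: "k = 2 * m" by (elim evenE)
  have "real (2 * m) * (LINT x|gauss. x ^ (2 * m - 1)) = 0"
  proof (cases m)
    case (Suc n)
    hence "2 * m - 1 = 2 * n + 1" by simp
    thus ?thesis using integral_std_normal_moment_odd[of n] by (simp add: integral_gauss del: power_Suc)
  qed simp
  moreover have "(LINT x|gauss. x ^ Suc (2 * m)) = 0"
    using integral_std_normal_moment_odd[of m] by (simp add: integral_gauss del: power_Suc)
  ultimately show ?thesis unfolding m by simp
next
  case False
  then obtain m where m: "k = 2 * m + 1" by (elim oddE)
  have "(LINT x|gauss. x ^ (2 * Suc m)) = fact (2 * Suc m) / (2 ^ Suc m * fact (Suc m))"
    using integral_std_normal_moment_even[of "Suc m"] by (subst integral_gauss) auto
  also have "\<dots> = real (2 * m + 1) * (fact (2 * m) / (2 ^ m * fact m))"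
    by (simp add: divide_simps)
  also have "\<dots> = real (2 * m + 1) * (LINT x|gauss. x ^ (2 * m))"
    using integral_std_normal_moment_even[of m] by (subst integral_gauss) auto
  finally show ?thesis unfolding m by simp
qed

lemma pderiv_sum: "pderiv (\<Sum>i\<in>I. f i) = (\<Sum>i\<in>I. pderiv (f i))"
  by (induction I rule: infinite_finite_induct) (simp_all add: pderiv_add)

text \<open>Stein's identity. For polynomials it follows from the moment recursion by linearity,
  with no boundary terms to estimate.\<close>

lemma gauss_stein: "(LINT x|gauss. x * poly p x) = (LINT x|gauss. poly (pderiv p) x)"
proof -
  have "(LINT x|gauss. x * poly p x) = (LINT x|gauss. (\<Sum>i\<le>degree p. coeff p i * x ^ Suc i))"
    by (intro Bochner_Integration.integral_cong)
      (auto simp: poly_altdef sum_distrib_left algebra_simps)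
  also have "\<dots> = (\<Sum>i\<le>degree p. coeff p i * (LINT x|gauss. x ^ Suc i))"
    using integrable_gauss_power by (subst Bochner_Integration.integral_sum) (auto simp del: power_Suc)
  also have "\<dots> = (\<Sum>i\<le>degree p. (real i * coeff p i) * (LINT x|gauss. x ^ (i - 1)))"
    by (intro sum.cong) (auto simp: gauss_moment_rec simp del: power_Suc)
  also have "\<dots> = (LINT x|gauss. (\<Sum>i\<le>degree p. (real i * coeff p i) * x ^ (i - 1)))"
    using integrable_gauss_power by (subst Bochner_Integration.integral_sum) auto
  also have "(\<lambda>x. \<Sum>i\<le>degree p. (real i * coeff p i) * x ^ (i - 1)) = poly (pderiv p)"
  proof
    fix x
    have "poly (pderiv p) x = poly (pderiv (\<Sum>i\<le>degree p. monom (coeff p i) i)) x"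
      by (simp only: poly_as_sum_of_monoms)
    also have "\<dots> = (\<Sum>i\<le>degree p. (real i * coeff p i) * x ^ (i - 1))"
      by (simp add: pderiv_sum pderiv_monom poly_sum poly_monom)
    finally show "(\<Sum>i\<le>degree p. (real i * coeff p i) * x ^ (i - 1)) = poly (pderiv p) x" by simp
  qed
  finally show ?thesis .
qed

section \<open>Random variables with finite moments of all orders\<close>

text \<open>Square integrability is lost under products, whereas this property is stable under sums
  and products. It thus settles integrability for every polynomial expression in Gaussian
  variables.\<close>

definition has_all_moments :: "'a measure \<Rightarrow> ('a \<Rightarrow> real) \<Rightarrow> bool" where
  "has_all_moments M f \<longleftrightarrow> f \<in> borel_measurable M \<and> (\<forall>n. integrable M (\<lambda>x. \<bar>f x\<bar> ^ n))"

lemma has_all_moments_integrable: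
  assumes "has_all_moments M f"
  shows "integrable M f"
proof -
  have "integrable M (\<lambda>x. \<bar>f x\<bar> ^ 1)" "f \<in> borel_measurable M"
    using assms unfolding has_all_moments_def by blast+
  thus ?thesis by (simp add: integrable_abs_iff)
qed

lemma has_all_moments_mult:
  assumes "has_all_moments M f" "has_all_moments M g"
  shows "has_all_moments M (\<lambda>x. f x * g x)"
  unfolding has_all_moments_def
proof (intro conjI allI)
  show [measurable]: "(\<lambda>x. f x * g x) \<in> borel_measurable M"
    using assms by (auto simp: has_all_moments_def)
  fix n
  have int: "integrable M (\<lambda>x. \<bar>f x\<bar> ^ (n * 2) + \<bar>g x\<bar> ^ (n * 2))"
    using assms unfolding has_all_moments_def by (intro Bochner_Integration.integrable_add) blast+
  have "a * b \<le> a\<^sup>2 + b\<^sup>2" for a b :: real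
  proof -
    have "2 * a * b \<le> a\<^sup>2 + b\<^sup>2" "0 \<le> a\<^sup>2 + b\<^sup>2" by (rule sum_squares_bound) simp
    thus ?thesis by linarith
  qed
  from this[of "\<bar>f _\<bar> ^ n" "\<bar>g _\<bar> ^ n"]
  have "\<bar>f x * g x\<bar> ^ n \<le> \<bar>f x\<bar> ^ (n * 2) + \<bar>g x\<bar> ^ (n * 2)" for x
    unfolding abs_mult power_mult_distrib power_mult .
  thus "integrable M (\<lambda>x. \<bar>f x * g x\<bar> ^ n)"
    by (intro Bochner_Integration.integrable_bound[OF int]) auto
qed

lemma has_all_moments_add:
  assumes "has_all_moments M f" "has_all_moments M g"
  shows "has_all_moments M (\<lambda>x. f x + g x)"
  unfolding has_all_moments_def
proof (intro conjI allI)
  show [measurable]: "(\<lambda>x. f x + g x) \<in> borel_measurable M"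
    using assms by (auto simp: has_all_moments_def)
  fix n
  have int: "integrable M (\<lambda>x. 2 ^ n * (\<bar>f x\<bar> ^ n + \<bar>g x\<bar> ^ n))"
    using assms by (auto simp: has_all_moments_def)
  have "\<bar>a + b\<bar> ^ n \<le> 2 ^ n * (\<bar>a\<bar> ^ n + \<bar>b\<bar> ^ n)" for a b :: real
  proof -
    have "\<bar>a + b\<bar> ^ n \<le> (2 * max \<bar>a\<bar> \<bar>b\<bar>) ^ n" by (intro power_mono) auto
    also have "\<dots> = 2 ^ n * max \<bar>a\<bar> \<bar>b\<bar> ^ n" by (simp add: power_mult_distrib)
    also have "\<dots> \<le> 2 ^ n * (\<bar>a\<bar> ^ n + \<bar>b\<bar> ^ n)" by (intro mult_left_mono) (auto simp: max_def)
    finally show ?thesis .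
  qed
  thus "integrable M (\<lambda>x. \<bar>f x + g x\<bar> ^ n)"
    by (intro Bochner_Integration.integrable_bound[OF int]) auto
qed

lemma (in finite_measure) has_all_moments_const: "has_all_moments M (\<lambda>_. c)"
  by (simp add: has_all_moments_def)

lemma (in finite_measure) has_all_moments_sum:
  assumes "\<And>i. i \<in> I \<Longrightarrow> has_all_moments M (f i)"
  shows "has_all_moments M (\<lambda>x. \<Sum>i\<in>I. f i x)"
  using assms by (induction I rule: infinite_finite_induct)
    (auto intro: has_all_moments_const has_all_moments_add)

lemma (in finite_measure) has_all_moments_prod:
  assumes "\<And>i. i \<in> I \<Longrightarrow> has_all_moments M (f i)"
  shows "has_all_moments M (\<lambda>x. \<Prod>i\<in>I. f i x)"
  using assms by (induction I rule: infinite_finite_induct)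
    (auto intro: has_all_moments_const has_all_moments_mult)

lemma (in finite_measure) has_all_moments_poly:
  assumes "has_all_moments M f"
  shows "has_all_moments M (\<lambda>x. poly p (f x))"
proof (induction p)
  case (pCons a p)
  show ?case
    unfolding poly_pCons
    by (intro has_all_moments_add has_all_moments_const has_all_moments_mult assms pCons.IH)
qed (simp add: has_all_moments_const)

text \<open>The joint law of the \<open>Z x\<close> is only accessed through Gaussian integration by parts; their
  independence is never established.\<close>

locale orthonormal_combinations =
  fixes J :: "'j set" and K :: "'k set" and a :: "'k \<Rightarrow> 'j \<Rightarrow> real"
  assumes finite_J: "finite J" and finite_K: "finite K"
    and orthonormal: "\<And>x y. x \<in> K \<Longrightarrow> y \<in> K \<Longrightarrow> (\<Sum>j\<in>J. a x j * a y j) = (if x = y then 1 else 0)"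
begin

definition Z :: "'k \<Rightarrow> ('j \<Rightarrow> real) \<Rightarrow> real" where
  "Z x v = (\<Sum>j\<in>J. a x j * v j)"

text \<open>One polynomial per index, so that \<open>p(x := u)\<close> changes a single factor; the
  functional is linear in \<open>u\<close>.\<close>

definition poly_mean :: "('k \<Rightarrow> real poly) \<Rightarrow> real" where
  "poly_mean p = (LINT v|PiM J (\<lambda>_. gauss). (\<Prod>x\<in>K. poly (p x) (Z x v)))"

sublocale P: product_prob_space "\<lambda>_. gauss" J
  by (rule product_prob_spaceI) (rule prob_space_gauss)


lemma has_all_moments_coord:
  assumes "j \<in> J"
  shows "has_all_moments (PiM J (\<lambda>_. gauss)) (\<lambda>v. v j)"
  unfolding has_all_moments_def
proof (intro conjI allI)
  have [measurable]: "(\<lambda>v. v j) \<in> measurable (PiM J (\<lambda>_. gauss)) gauss"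
    using assms by (rule measurable_component_singleton)
  moreover have "measurable (PiM J (\<lambda>_. gauss)) gauss = borel_measurable (PiM J (\<lambda>_. gauss))"
    by (rule measurable_cong_sets) auto
  ultimately show "(\<lambda>v. v j) \<in> borel_measurable (PiM J (\<lambda>_. gauss))" by simp
  fix n
  have "integrable (distr (PiM J (\<lambda>_. gauss)) gauss (\<lambda>v. v j)) (\<lambda>x. \<bar>x\<bar> ^ n)"
    using integrable_gauss_abs_power by (subst distr_PiM_component) (auto intro: prob_space_gauss assms)
  thus "integrable (PiM J (\<lambda>_. gauss)) (\<lambda>v. \<bar>v j\<bar> ^ n)"
    by (subst (asm) integrable_distr_eq) auto
qed

lemma has_all_moments_Z: "has_all_moments (PiM J (\<lambda>_. gauss)) (Z x)"
  unfolding Z_def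
  by (intro P.P.has_all_moments_sum has_all_moments_mult P.P.has_all_moments_const has_all_moments_coord)

lemma has_all_moments_poly_prod:
  "has_all_moments (PiM J (\<lambda>_. gauss)) (\<lambda>v. \<Prod>x\<in>K. poly (p x) (Z x v))"
  by (intro P.P.has_all_moments_prod P.P.has_all_moments_poly has_all_moments_Z)

lemmas integrable_poly_prod = has_all_moments_integrable[OF has_all_moments_poly_prod]

text \<open>By Fubini all coordinates except \<open>v j\<close> can be frozen. The product is then a
  polynomial in \<open>v j\<close>, to which Stein's identity applies; the product rule gives the
  sum over \<open>x\<close> and the chain rule the factors \<open>a x j\<close>.\<close>

lemma stein_coord:
  assumes "j \<in> J"
  shows "(LINT v|PiM J (\<lambda>_. gauss). v j * (\<Prod>x\<in>K. poly (p x) (Z x v))) =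
    (\<Sum>x\<in>K. a x j * poly_mean (p(x := pderiv (p x))))"
proof -
  define I where "I = J - {j}"
  have J: "J = insert j I" "finite I" "j \<notin> I" using assms finite_J by (auto simp: I_def)
  have fubini: "(LINT v|PiM J (\<lambda>_. gauss). f v) = (LINT v|PiM I (\<lambda>_. gauss). (LINT y|gauss. f (v(j := y))))"
    if "integrable (PiM J (\<lambda>_. gauss)) f" for f :: "_ \<Rightarrow> real"
    unfolding J(1) by (rule P.product_integral_insert) (use J that in auto)
  have inner: "(LINT y|gauss. (v(j := y)) j * (\<Prod>x\<in>K. poly (p x) (Z x (v(j := y))))) =
      (LINT y|gauss. (\<Sum>x\<in>K. a x j * (\<Prod>z\<in>K. poly ((p(x := pderiv (p x))) z) (Z z (v(j := y))))))" for v
  proof -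
    define c where "c x = (\<Sum>i\<in>I. a x i * v i)" for x
    have Z: "Z x (v(j := y)) = c x + y * a x j" for x y
    proof -
      have "Z x (v(j := y)) = (\<Sum>i\<in>insert j I. a x i * (v(j := y)) i)"
        unfolding Z_def J(1)[symmetric] ..
      also have "\<dots> = a x j * y + (\<Sum>i\<in>I. a x i * (v(j := y)) i)"
        using J(2,3) by (subst sum.insert) auto
      also have "(\<Sum>i\<in>I. a x i * (v(j := y)) i) = c x"
        unfolding c_def using J(3) by (intro sum.cong) auto
      finally show ?thesis by (simp del: fun_upd_apply)
    qed
    define q where "q = (\<Prod>x\<in>K. pcompose (p x) [:c x, a x j:])"
    have 1: "poly q y = (\<Prod>x\<in>K. poly (p x) (Z x (v(j := y))))" for y
      by (simp add: q_def poly_prod poly_pcompose Z)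
    have 2: "poly (pderiv q) y =
        (\<Sum>x\<in>K. a x j * (\<Prod>z\<in>K. poly ((p(x := pderiv (p x))) z) (Z z (v(j := y)))))" for y
      unfolding q_def pderiv_prod poly_sum
    proof (intro sum.cong refl)
      fix x assume x: "x \<in> K"
      have "(\<Prod>z\<in>K. poly ((p(x := pderiv (p x))) z) (Z z (v(j := y)))) =
          poly (pderiv (p x)) (Z x (v(j := y))) *
          (\<Prod>z\<in>K - {x}. poly ((p(x := pderiv (p x))) z) (Z z (v(j := y))))"
        using x finite_K by (subst prod.remove) auto
      also have "(\<Prod>z\<in>K - {x}. poly ((p(x := pderiv (p x))) z) (Z z (v(j := y)))) =
          (\<Prod>z\<in>K - {x}. poly (p z) (Z z (v(j := y))))"
        by (intro prod.cong) auto
      finally show "poly ((\<Prod>z\<in>K - {x}. pcompose (p z) [:c z, a z j:]) * pderiv (pcompose (p x) [:c x, a x j:])) y =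
          a x j * (\<Prod>z\<in>K. poly ((p(x := pderiv (p x))) z) (Z z (v(j := y))))"
        by (simp add: poly_prod poly_pcompose Z pderiv_pcompose pderiv_pCons mult_ac del: fun_upd_apply)
    qed
    show ?thesis using gauss_stein[of q] unfolding 1 2 by simp
  qed
  have "(LINT v|PiM J (\<lambda>_. gauss). v j * (\<Prod>x\<in>K. poly (p x) (Z x v))) =
      (LINT v|PiM J (\<lambda>_. gauss). (\<Sum>x\<in>K. a x j * (\<Prod>z\<in>K. poly ((p(x := pderiv (p x))) z) (Z z v))))"
    by (subst (1 2) fubini)
      (auto simp only: inner intro!: has_all_moments_integrable has_all_moments_mult has_all_moments_coord[OF assms]
        has_all_moments_poly_prod P.P.has_all_moments_sum P.P.has_all_moments_const)
  also have "\<dots> = (\<Sum>x\<in>K. a x j * poly_mean (p(x := pderiv (p x))))"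
    unfolding poly_mean_def by (subst Bochner_Integration.integral_sum)
      (auto intro!: integrable_mult_right integrable_poly_prod simp del: fun_upd_apply)
  finally show ?thesis .
qed

text \<open>Expanding \<open>Z x\<close> over the coordinates yields the Gram matrix of the rows of
  \<open>a\<close>. Its being the identity leaves the single term \<open>y = x\<close>, just as if
  the \<open>Z x\<close> were independent standard normal variables.\<close>

lemma stein_combination:
  assumes "x \<in> K"
  shows "(LINT v|PiM J (\<lambda>_. gauss). Z x v * (\<Prod>x\<in>K. poly (p x) (Z x v))) = poly_mean (p(x := pderiv (p x)))"
proof -
  have "(LINT v|PiM J (\<lambda>_. gauss). Z x v * (\<Prod>x\<in>K. poly (p x) (Z x v))) =
      (LINT v|PiM J (\<lambda>_. gauss). (\<Sum>j\<in>J. a x j * (v j * (\<Prod>x\<in>K. poly (p x) (Z x v)))))"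
    by (subst Z_def) (simp add: sum_distrib_right mult.assoc)
  also have "\<dots> = (\<Sum>j\<in>J. a x j * (LINT v|PiM J (\<lambda>_. gauss). v j * (\<Prod>x\<in>K. poly (p x) (Z x v))))"
    by (subst Bochner_Integration.integral_sum)
      (auto intro!: integrable_mult_right has_all_moments_integrable has_all_moments_mult has_all_moments_coord
        has_all_moments_poly_prod)
  also have "\<dots> = (\<Sum>j\<in>J. \<Sum>y\<in>K. a x j * a y j * poly_mean (p(y := pderiv (p y))))"
    by (intro sum.cong refl) (simp add: stein_coord sum_distrib_left mult.assoc)
  also have "\<dots> = (\<Sum>y\<in>K. (\<Sum>j\<in>J. a x j * a y j) * poly_mean (p(y := pderiv (p y))))"
    by (subst sum.swap) (simp add: sum_distrib_right)
  also have "\<dots> = (\<Sum>y\<in>K. if x = y then poly_mean (p(y := pderiv (p y))) else 0)"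
    using assms by (intro sum.cong refl) (simp add: orthonormal)
  also have "\<dots> = poly_mean (p(x := pderiv (p x)))"
    using assms finite_K by simp
  finally show ?thesis .
qed

lemma poly_prod_upd:
  assumes "x \<in> K"
  shows "(\<Prod>z\<in>K. poly ((p(x := u)) z) (Z z v)) = poly u (Z x v) * (\<Prod>z\<in>K - {x}. poly (p z) (Z z v))"
  using assms finite_K by (subst prod.remove[of _ x]) (auto intro!: prod.cong)

lemma poly_mean_add:
  assumes "x \<in> K"
  shows "poly_mean (p(x := u + w)) = poly_mean (p(x := u)) + poly_mean (p(x := w))"
proof -
  have "poly_mean (p(x := u + w)) = (LINT v|PiM J (\<lambda>_. gauss).
      (\<Prod>z\<in>K. poly ((p(x := u)) z) (Z z v)) + (\<Prod>z\<in>K. poly ((p(x := w)) z) (Z z v)))"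
    unfolding poly_mean_def poly_prod_upd[OF assms] poly_add distrib_right ..
  also have "\<dots> = poly_mean (p(x := u)) + poly_mean (p(x := w))"
    unfolding poly_mean_def by (intro Bochner_Integration.integral_add integrable_poly_prod)
  finally show ?thesis .
qed

lemma poly_mean_smult:
  assumes "x \<in> K"
  shows "poly_mean (p(x := smult c u)) = c * poly_mean (p(x := u))"
  unfolding poly_mean_def poly_prod_upd[OF assms] by (simp add: mult.assoc)

text \<open>Multiplication by the variable minus differentiation is the adjoint of differentiation
  under the Gaussian law. In the product rule, the term where \<open>hermite_poly n\<close> is
  differentiated is exactly the one that the recursion subtracts.\<close>

lemma poly_mean_hermite_Suc:
  assumes "x \<in> K"
  shows "poly_mean (p(x := hermite_poly (Suc n) * q)) = poly_mean (p(x := hermite_poly n * pderiv q))"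
proof -
  let ?h = "hermite_poly n" and ?r = "p(x := hermite_poly n * q)"
  have "poly_mean (p(x := [:0, 1:] * (?h * q))) = (LINT v|PiM J (\<lambda>_. gauss). Z x v * (\<Prod>z\<in>K. poly (?r z) (Z z v)))"
    unfolding poly_mean_def poly_prod_upd[OF assms] by (simp add: mult.assoc)
  also have "\<dots> = poly_mean (p(x := ?h * pderiv q + q * pderiv ?h))"
    by (subst stein_combination[OF assms]) (simp add: pderiv_mult)
  also have "\<dots> = poly_mean (p(x := ?h * pderiv q)) + poly_mean (p(x := q * pderiv ?h))"
    by (rule poly_mean_add[OF assms])
  finally have "poly_mean (p(x := [:0, 1:] * (?h * q))) = \<dots>" .
  moreover have "[:0, 1:] * (?h * q) = hermite_poly (Suc n) * q + q * pderiv ?h"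
    by (simp add: algebra_simps)
  ultimately show ?thesis by (simp only: poly_mean_add[OF assms])
qed

text \<open>Each step takes one degree from both factors and releases a factor from
  \<open>pderiv_hermite_poly\<close>; for equal degrees these multiply to \<open>fact n\<close>. For
  unequal degrees the derivative of the constant 1 eventually appears.\<close>

lemma poly_mean_hermite_mult:
  assumes "x \<in> K"
  shows "poly_mean (p(x := hermite_poly n * hermite_poly m)) = (if n = m then fact n else 0) * poly_mean (p(x := 1))"
proof (induction n arbitrary: m)
  case 0
  have zero: "poly_mean (p(x := 0)) = 0" using poly_mean_smult[OF assms, of p 0 0] by simp
  \<comment> \<open>Here \<open>hermite_poly m\<close> plays the role of the factor to be lowered
    and \<open>q = 1\<close> has derivative 0; \<open>m - 1\<close> matters only for positive
    \<open>m\<close>.\<close>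
  show ?case using poly_mean_hermite_Suc[OF assms, of p "m - 1" 1] zero
    by (cases m) (simp_all del: hermite_poly.simps(2) fun_upd_apply)
next
  case (Suc n)
  have zero: "poly_mean (p(x := 0)) = 0" using poly_mean_smult[OF assms, of p 0 0] by simp
  show ?case
  proof (cases m)
    case 0
    thus ?thesis using zero poly_mean_hermite_Suc[OF assms, of p n 1]
      by (simp del: hermite_poly.simps(2) fun_upd_apply)
  next
    case (Suc m')
    thus ?thesis unfolding Suc poly_mean_hermite_Suc[OF assms] pderiv_hermite_poly mult_smult_right
        poly_mean_smult[OF assms] Suc.IH by (simp del: fun_upd_apply)
  qed
qed

text \<open>The factorization that independence would provide is obtained by treating one index
  after the other. The set \<open>A\<close> holds the indices that still carry a nontrivial
  polynomial.\<close>

lemma poly_mean_hermite_prod: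
  "poly_mean (\<lambda>x. hermite_poly (n x) * hermite_poly (m x)) = (\<Prod>x\<in>K. if n x = m x then fact (n x) else 0)"
proof -
  have "poly_mean (\<lambda>x. if x \<in> A then hermite_poly (n x) * hermite_poly (m x) else 1) =
      (\<Prod>x\<in>A. if n x = m x then fact (n x) else 0)" if "A \<subseteq> K" "finite A" for A
    using that(2,1)
  proof (induction A rule: finite_induct)
    case empty
    show ?case by (simp add: poly_mean_def P.P.prob_space)
  next
    case (insert x A)
    let ?p = "\<lambda>x. if x \<in> A then hermite_poly (n x) * hermite_poly (m x) else 1"
    have "(\<lambda>y. if y \<in> insert x A then hermite_poly (n y) * hermite_poly (m y) else 1) =
        ?p(x := hermite_poly (n x) * hermite_poly (m x))" by auto
    moreover have "?p(x := 1) = ?p" using insert.hyps by auto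
    ultimately show ?case using insert poly_mean_hermite_mult[of x ?p "n x" "m x"] by simp
  qed
  from this[of K] show ?thesis
    using finite_K by (simp add: poly_mean_def)
qed

end

section \<open>Brownian increments and products of Hermite polynomials\<close>

text \<open>Brownian motion provides independence of the vector increments over time, and separately
  of the components within each increment. Joint independence follows in two stages, because an
  intersection of component events at a fixed \<open>i\<close> is again a Borel event of
  \<open>V i\<close>.\<close>

lemma (in prob_space) indep_vars_components:
  fixes V :: "'i \<Rightarrow> 'a \<Rightarrow> real ^ 'D"
  assumes "finite I" "I \<noteq> {}" and indep: "indep_vars (\<lambda>_. borel) V I"
    and comp: "\<And>i. i \<in> I \<Longrightarrow> indep_vars (\<lambda>_. borel) (\<lambda>r \<omega>. V i \<omega> $ r) UNIV"
  shows "indep_vars (\<lambda>_. borel) (\<lambda>(i, r) \<omega>. V i \<omega> $ r) (I \<times> UNIV)"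
proof -
  let ?X = "\<lambda>(i, r) \<omega>. V i \<omega> $ r"
  let ?F = "\<lambda>x. {?X x -` B \<inter> space M | B. B \<in> sets borel}"
  have rv: "?X x \<in> borel_measurable M" if "x \<in> I \<times> UNIV" for x
    using comp that by (auto simp: indep_vars_def2)
  have "prob (\<Inter>x\<in>I \<times> UNIV. A x) = (\<Prod>x\<in>I \<times> UNIV. prob (A x))" if A: "A \<in> Pi (I \<times> UNIV) ?F" for A
  proof -
    have "\<forall>x\<in>I \<times> UNIV. \<exists>B\<in>sets borel. A x = ?X x -` B \<inter> space M" using A by blast
    then obtain B where B: "\<And>x. x \<in> I \<times> UNIV \<Longrightarrow> B x \<in> sets borel"
        "\<And>x. x \<in> I \<times> UNIV \<Longrightarrow> A x = ?X x -` B x \<inter> space M"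
      by metis
    define C where "C i = (\<Inter>r. A (i, r))" for i
    have "prob (\<Inter>i\<in>I. C i) = (\<Prod>i\<in>I. prob (C i))"
    proof (rule indep_setsD)
      show "indep_sets (\<lambda>i. {V i -` B \<inter> space M | B. B \<in> sets borel}) I"
        using indep by (simp add: indep_vars_def2)
      show "\<forall>i\<in>I. C i \<in> {V i -` B \<inter> space M | B. B \<in> sets borel}"
      proof
        fix i assume i: "i \<in> I"
        have [measurable]: "B (i, r) \<in> sets borel" for r using B(1) i by simp
        have "{v :: real ^ 'D. \<forall>r\<in>UNIV. v $ r \<in> B (i, r)} \<in> sets borel" by measurable
        moreover have "C i = V i -` {v. \<forall>r\<in>UNIV. v $ r \<in> B (i, r)} \<inter> space M"
          using B(2) i by (auto simp: C_def)
        ultimately show "C i \<in> {V i -` B \<inter> space M | B. B \<in> sets borel}" by blast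
      qed
    qed (use assms in auto)
    also have "\<dots> = (\<Prod>i\<in>I. \<Prod>r\<in>UNIV. prob (A (i, r)))"
    proof (intro prod.cong refl)
      fix i assume i: "i \<in> I"
      show "prob (C i) = (\<Prod>r\<in>UNIV. prob (A (i, r)))"
        unfolding C_def
      proof (rule indep_setsD)
        show "indep_sets (\<lambda>r. {(\<lambda>\<omega>. V i \<omega> $ r) -` B \<inter> space M | B. B \<in> sets borel}) UNIV"
          using comp[OF i] by (simp add: indep_vars_def2)
        show "\<forall>r\<in>UNIV. A (i, r) \<in> {(\<lambda>\<omega>. V i \<omega> $ r) -` B \<inter> space M | B. B \<in> sets borel}"
          using B i by auto
      qed auto
    qed
    also have "\<dots> = (\<Prod>x\<in>I \<times> UNIV. prob (A x))"
      by (simp add: prod.cartesian_product)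
    finally show ?thesis by (simp add: C_def INF_Sigma)
  qed
  \<comment> \<open>Since \<open>space M\<close> belongs to every class, the product formula for the
    full index set covers all its subsets, as \<open>indep_sets_finite\<close> requires.\<close>
  moreover have "?F x \<subseteq> events" "space M \<in> ?F x" if "x \<in> I \<times> UNIV" for x
    using rv[OF that] by (auto intro!: exI[of _ UNIV] measurable_sets)
  ultimately have "indep_sets ?F (I \<times> UNIV)"
    using assms by (subst indep_sets_finite) auto
  thus ?thesis using rv by (simp add: indep_vars_def2)
qed

section \<open>From the Gaussian product measure back to the Brownian motion\<close>

lemma has_all_moments_distr:
  assumes "has_all_moments (distr M N f) g" "f \<in> measurable M N"
  shows "has_all_moments M (\<lambda>x. g (f x))"
  using assms unfolding has_all_moments_def by (auto simp: integrable_distr_eq)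

lemma normalized_hermite_eq_poly: "normalized_hermite n x = poly (hermite_poly n) x / sqrt (fact n)"
  by (simp add: normalized_hermite_def hermite_eq_poly)

definition haar_variable :: "real \<Rightarrow> (real \<Rightarrow> 'a \<Rightarrow> real ^ 'D) \<Rightarrow> (nat \<times> nat) \<times> 'D \<Rightarrow> 'a \<Rightarrow> real" where
  "haar_variable T W = (\<lambda>((i, k), r). haar_gaussian T W r i k)"

definition hermite_product ::
  "real \<Rightarrow> (real \<Rightarrow> 'a \<Rightarrow> real ^ 'D) \<Rightarrow> ((nat \<times> nat) \<times> 'D \<Rightarrow> nat) \<Rightarrow> 'a \<Rightarrow> real" where
  "hermite_product T W \<alpha> \<omega> = (\<Prod>x\<in>mi_support \<alpha>. normalized_hermite (\<alpha> x) (haar_variable T W x \<omega>))"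

lemma chaoslet_eq: "chaoslet T W p q \<alpha> t \<omega> = haar T p q t * hermite_product T W \<alpha> \<omega>"
  unfolding chaoslet_def hermite_product_def haar_variable_def
  by (auto intro!: prod.cong simp: split_beta)

definition haar_index :: "((nat \<times> nat) \<times> 'D) set" where
  "haar_index = {((i, k), r). k < 2 ^ i}"

locale brownian = prob_space M for M :: "'a measure" +
  fixes T :: real and W :: "real \<Rightarrow> 'a \<Rightarrow> real ^ 'D"
  assumes T_pos: "T > 0" and brownian: "brownian_motion M T W"
begin

lemma W_measurable: "t \<in> {0..T} \<Longrightarrow> W t \<in> borel_measurable M"
  using brownian by (simp add: brownian_motion_def)

lemma increment_std_normal:
  assumes "j < 2 ^ L"
  shows "distributed M lborel (increment T W L (j, r)) std_normal_density"
proof -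
  let ?s = "grid T L j" and ?t = "grid T L (Suc j)"
  have s: "0 \<le> ?s" "?s < ?t" "?t \<le> T"
    using grid_mem[OF T_pos, of j L] grid_mem[OF T_pos, of "Suc j" L] assms T_pos
    by (auto simp: grid_def divide_strict_right_mono)
  hence "distributed M lborel (\<lambda>\<omega>. (W ?t \<omega> - W ?s \<omega>) $ r) (normal_density 0 (sqrt (?t - ?s)))"
    using brownian unfolding brownian_motion_def by blast
  hence "distributed M lborel (\<lambda>\<omega>. ((W ?t \<omega> - W ?s \<omega>) $ r - 0) / sqrt (?t - ?s)) std_normal_density"
    using normal_standard_normal_convert[of "sqrt (?t - ?s)"] s by simp
  moreover have "?t - ?s = T / 2 ^ L" by (simp add: grid_def field_simps)
  hence "(\<lambda>\<omega>. ((W ?t \<omega> - W ?s \<omega>) $ r - 0) / sqrt (?t - ?s)) = increment T W L (j, r)"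
    by (auto simp: increment_def real_sqrt_divide)
  ultimately show ?thesis by simp
qed

lemma increment_measurable: "x \<in> {..<2 ^ L} \<times> UNIV \<Longrightarrow> increment T W L x \<in> borel_measurable M"
  using distributed_measurable[OF increment_std_normal, of "fst x" L "snd x"] by auto

lemma indep_increments: "indep_vars (\<lambda>_. borel) (increment T W L) ({..<2 ^ L} \<times> UNIV)"
proof -
  let ?V = "\<lambda>j \<omega>. W (grid T L (Suc j)) \<omega> - W (grid T L j) \<omega>"
  have "indep_vars (\<lambda>_. borel) ?V {..<2 ^ L}"
  proof -
    have "(\<forall>i\<le>2 ^ L. grid T L i \<in> {0..T}) \<and> (\<forall>i<2 ^ L. grid T L i < grid T L (Suc i))"
      using grid_mem[OF T_pos] T_pos by (auto simp: grid_def divide_strict_right_mono)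
    thus ?thesis using brownian unfolding brownian_motion_def by blast
  qed
  moreover have "indep_vars (\<lambda>_. borel) (\<lambda>r \<omega>. ?V j \<omega> $ r) UNIV" if "j \<in> {..<2 ^ L}" for j
  proof -
    have "0 \<le> grid T L j" "grid T L j < grid T L (Suc j)" "grid T L (Suc j) \<le> T"
      using grid_mem[OF T_pos, of j L] grid_mem[OF T_pos, of "Suc j" L] that T_pos
      by (auto simp: grid_def divide_strict_right_mono)
    thus ?thesis using brownian unfolding brownian_motion_def by blast
  qed
  ultimately have "indep_vars (\<lambda>_. borel) (\<lambda>(j, r) \<omega>. ?V j \<omega> $ r) ({..<2 ^ L} \<times> UNIV)"
    by (intro indep_vars_components) (auto simp: lessThan_empty_iff)
  hence "indep_vars (\<lambda>_. borel) (\<lambda>x \<omega>. sqrt (2 ^ L) / sqrt T * (case x of (j, r) \<Rightarrow> \<lambda>\<omega>. ?V j \<omega> $ r) \<omega>) ({..<2 ^ L} \<times> UNIV)"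
    by (rule indep_vars_compose2) measurable
  thus ?thesis unfolding increment_def by (simp add: case_prod_unfold)
qed

lemma distr_increments:
  defines "J \<equiv> \<lambda>L. {..<2 ^ L} \<times> (UNIV :: 'D set)"
  shows "distr M (PiM (J L) (\<lambda>_. borel)) (\<lambda>\<omega>. \<lambda>x\<in>J L. increment T W L x \<omega>) = PiM (J L) (\<lambda>_. gauss)"
proof -
  have "distr M (PiM (J L) (\<lambda>_. borel)) (\<lambda>\<omega>. \<lambda>x\<in>J L. increment T W L x \<omega>) =
      PiM (J L) (\<lambda>x. distr M borel (increment T W L x))"
    unfolding J_def by (rule indep_vars_iff_distr_eq_PiM'[THEN iffD1])
      (auto intro: indep_increments increment_measurable simp: lessThan_empty_iff)
  also have "\<dots> = PiM (J L) (\<lambda>_. gauss)"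
  proof (rule PiM_cong[OF refl])
    fix x assume "x \<in> J L"
    then obtain j r where x: "x = (j, r)" "j < 2 ^ L" by (auto simp: J_def)
    have "distr M borel (increment T W L x) = distr M lborel (increment T W L x)"
      by (intro distr_cong) auto
    also have "\<dots> = gauss"
      using distributed_distr_eq_density[OF increment_std_normal[OF x(2)]] by (simp add: x gauss_def)
    finally show "distr M borel (increment T W L x) = gauss" .
  qed
  finally show ?thesis .
qed

text \<open>Two finite supports are resolved by one grid. On it the Haar variables are orthonormal
  combinations of finitely many increments, whose joint law is the product of copies of
  \<open>gauss\<close>, so moments can be computed there by
  \<open>poly_mean_hermite_prod\<close>.\<close>

lemma hermite_product_moments:
  fixes \<alpha> \<beta> :: "(nat \<times> nat) \<times> 'D \<Rightarrow> nat"
  assumes "finite (mi_support \<alpha>)" "mi_support \<alpha> \<subseteq> haar_index"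
    and "finite (mi_support \<beta>)" "mi_support \<beta> \<subseteq> haar_index"
  shows "has_all_moments M (hermite_product T W \<alpha>)"
    and "expectation (\<lambda>\<omega>. hermite_product T W \<alpha> \<omega> * hermite_product T W \<beta> \<omega>) = (if \<alpha> = \<beta> then 1 else 0)"
proof -
  define K where "K = mi_support \<alpha> \<union> mi_support \<beta>"
  have K: "finite K" "K \<subseteq> haar_index" using assms by (auto simp: K_def)
  \<comment> \<open>Strictly above every level in \<open>K\<close>, as \<open>haar_coeff\<close>
    needs; 0 is inserted because \<open>K\<close> may be empty.\<close>
  define L where "L = Suc (Max (insert 0 ((\<lambda>x. fst (fst x)) ` K)))"
  have L: "i < L" if "((i, k), r) \<in> K" for i k r
    unfolding L_def less_Suc_eq_le using that K(1) by (intro Max_ge) force+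
  define J where "J = {..<2 ^ L :: nat} \<times> (UNIV :: 'D set)"
  \<comment> \<open>Block structure over the components of \<open>W\<close>: a variable of component
    \<open>r\<close> involves only the increments of that component, so different components are
    orthogonal.\<close>
  define a :: "(nat \<times> nat) \<times> 'D \<Rightarrow> nat \<times> 'D \<Rightarrow> real" where
    "a = (\<lambda>((i, k), r) (j, r'). if r = r' then haar_coeff L i k j else 0)"
  have sum_J: "(\<Sum>x\<in>J. f x) = (\<Sum>r\<in>UNIV. \<Sum>j<2 ^ L. f (j, r))" for f :: "nat \<times> 'D \<Rightarrow> real"
    unfolding J_def sum.cartesian_product' by (rule sum.swap)
  interpret orthonormal_combinations J K a
  proof
    show "finite J" by (simp add: J_def)
    show "finite K" by (rule K)
    fix x y assume xy: "x \<in> K" "y \<in> K"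
    obtain i k r i' k' r' where eq: "x = ((i, k), r)" "y = ((i', k'), r')"
      by (metis surj_pair)
    have k: "k < 2 ^ i" "k' < 2 ^ i'" "i < L" "i' < L"
      using xy K(2) L unfolding eq haar_index_def by auto
    have "(\<Sum>j\<in>J. a x j * a y j) = (\<Sum>s\<in>UNIV. if s = r then if r = r' then
        (\<Sum>j<2 ^ L. haar_coeff L i k j * haar_coeff L i' k' j) else 0 else 0)"
      unfolding sum_J by (intro sum.cong) (auto simp: a_def eq)
    thus "(\<Sum>j\<in>J. a x j * a y j) = (if x = y then 1 else 0)"
      using haar_coeff_orthonormal[OF k(1,3,2,4)] by (auto simp: eq)
  qed
  define \<xi> where "\<xi> \<omega> = (\<lambda>x\<in>J. increment T W L x \<omega>)" for \<omega>
  have \<xi>: "\<xi> \<in> measurable M (PiM J (\<lambda>_. borel))"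
    unfolding \<xi>_def J_def by (intro measurable_restrict increment_measurable)
  have distr: "distr M (PiM J (\<lambda>_. borel)) \<xi> = PiM J (\<lambda>_. gauss)"
    using distr_increments[of L] by (simp add: J_def \<xi>_def[abs_def])
  have Z: "haar_variable T W x \<omega> = Z x (\<xi> \<omega>)" if "x \<in> K" for x \<omega>
  proof -
    obtain i k r where eq: "x = ((i, k), r)" by (metis surj_pair)
    have k: "k < 2 ^ i" "i < L" using that K(2) L unfolding eq haar_index_def by auto
    have "Z x (\<xi> \<omega>) = (\<Sum>s\<in>UNIV. if s = r then (\<Sum>j<2 ^ L. haar_coeff L i k j * increment T W L (j, r) \<omega>) else 0)"
      unfolding Z_def sum_J by (intro sum.cong) (auto simp: a_def eq \<xi>_def J_def)
    thus ?thesis using haar_gaussian_eq_sum_increment[OF k] by (simp add: haar_variable_def eq)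
  qed
  define c :: "((nat \<times> nat) \<times> 'D \<Rightarrow> nat) \<Rightarrow> real" where "c \<gamma> = (\<Prod>x\<in>K. 1 / sqrt (fact (\<gamma> x)))" for \<gamma>
  have prod: "hermite_product T W \<gamma> \<omega> = c \<gamma> * (\<Prod>x\<in>K. poly (hermite_poly (\<gamma> x)) (Z x (\<xi> \<omega>)))"
    if "mi_support \<gamma> \<subseteq> K" for \<gamma> \<omega>
  proof -
    have "hermite_product T W \<gamma> \<omega> = (\<Prod>x\<in>K. normalized_hermite (\<gamma> x) (haar_variable T W x \<omega>))"
      unfolding hermite_product_def using that K(1)
      by (intro prod.mono_neutral_left) (auto simp: mi_support_def normalized_hermite_eq_poly)
    thus ?thesis
      unfolding c_def prod.distrib[symmetric] by (simp add: Z normalized_hermite_eq_poly cong: prod.cong)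
  qed
  have sub: "mi_support \<alpha> \<subseteq> K" "mi_support \<beta> \<subseteq> K" by (auto simp: K_def)
  have "has_all_moments M (\<lambda>\<omega>. \<Prod>x\<in>K. poly (hermite_poly (\<alpha> x)) (Z x (\<xi> \<omega>)))"
    by (rule has_all_moments_distr[OF _ \<xi>]) (simp add: distr has_all_moments_poly_prod)
  thus "has_all_moments M (hermite_product T W \<alpha>)"
    unfolding prod[OF sub(1), abs_def] by (intro has_all_moments_mult has_all_moments_const)
  have "expectation (\<lambda>\<omega>. hermite_product T W \<alpha> \<omega> * hermite_product T W \<beta> \<omega>) =
      expectation (\<lambda>\<omega>. c \<alpha> * c \<beta> * (\<Prod>x\<in>K. poly (hermite_poly (\<alpha> x) * hermite_poly (\<beta> x)) (Z x (\<xi> \<omega>))))"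
    unfolding prod[OF sub(1)] prod[OF sub(2)] poly_mult prod.distrib by (simp add: mult_ac)
  also have "\<dots> = c \<alpha> * c \<beta> * poly_mean (\<lambda>x. hermite_poly (\<alpha> x) * hermite_poly (\<beta> x))"
  proof -
    let ?F = "\<lambda>v. \<Prod>x\<in>K. poly (hermite_poly (\<alpha> x) * hermite_poly (\<beta> x)) (Z x v)"
    have "?F \<in> borel_measurable (PiM J (\<lambda>_. gauss))"
      using has_all_moments_poly_prod[of "\<lambda>x. hermite_poly (\<alpha> x) * hermite_poly (\<beta> x)"]
      unfolding has_all_moments_def by (rule conjunct1)
    \<comment> \<open>By \<open>distr\<close>, the product of \<open>gauss\<close> is an image
      measure on the Borel product, so both have the same measurable functions.\<close>
    hence "?F \<in> borel_measurable (PiM J (\<lambda>_. borel))"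
      by (simp add: distr[symmetric])
    hence "expectation (\<lambda>\<omega>. ?F (\<xi> \<omega>)) = poly_mean (\<lambda>x. hermite_poly (\<alpha> x) * hermite_poly (\<beta> x))"
      unfolding poly_mean_def distr[symmetric] by (simp add: integral_distr[OF \<xi>])
    thus ?thesis by simp
  qed
  \<comment> \<open>Where the exponents agree, the factorial cancels the two square roots from
    \<open>c \<alpha>\<close> and \<open>c \<beta>\<close>.\<close>
  also have "\<dots> = (\<Prod>x\<in>K. if \<alpha> x = \<beta> x then 1 else 0)"
    unfolding c_def poly_mean_hermite_prod prod.distrib[symmetric]
    by (intro prod.cong) auto
  also have "\<dots> = (if \<alpha> = \<beta> then 1 else 0)"
  proof (cases "\<alpha> = \<beta>")
    case False
    then obtain x where "\<alpha> x \<noteq> \<beta> x" by blast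
    moreover from this have "x \<in> K" by (auto simp: K_def mi_support_def)
    ultimately show ?thesis using K(1) False by (auto intro!: prod_zero)
  qed simp
  finally show "expectation (\<lambda>\<omega>. hermite_product T W \<alpha> \<omega> * hermite_product T W \<beta> \<omega>) = (if \<alpha> = \<beta> then 1 else 0)" .
qed

end

section \<open>Square-integrable functions\<close>

lemma (in pair_sigma_finite)
  fixes f :: "'a \<Rightarrow> real" and g :: "'b \<Rightarrow> real"
  assumes f: "integrable M1 f" and g: "integrable M2 g"
  shows integrable_pair_mult: "integrable (M1 \<Otimes>\<^sub>M M2) (\<lambda>(x, y). f x * g y)"
    and integral_pair_mult: "(LINT z|(M1 \<Otimes>\<^sub>M M2). (case z of (x, y) \<Rightarrow> f x * g y)) = integral\<^sup>L M1 f * integral\<^sup>L M2 g"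
proof -
  have [measurable]: "f \<in> borel_measurable M1" "g \<in> borel_measurable M2" using f g by auto
  show *: "integrable (M1 \<Otimes>\<^sub>M M2) (\<lambda>(x, y). f x * g y)"
    by (rule Fubini_integrable) (use f g in \<open>auto simp: abs_mult\<close>)
  show "(LINT z|(M1 \<Otimes>\<^sub>M M2). (case z of (x, y) \<Rightarrow> f x * g y)) = integral\<^sup>L M1 f * integral\<^sup>L M2 g"
    using integral_fst'[OF *] by simp
qed

definition square_integrable :: "'a measure \<Rightarrow> ('a \<Rightarrow> 'b::euclidean_space) \<Rightarrow> bool" where
  "square_integrable M f \<longleftrightarrow> f \<in> borel_measurable M \<and> integrable M (\<lambda>x. (norm (f x))\<^sup>2)"

lemma square_integrable_measurable: "square_integrable M f \<Longrightarrow> f \<in> borel_measurable M"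
  by (simp add: square_integrable_def)

lemma norm_add_sq_le: "(norm (x + y))\<^sup>2 \<le> 2 * (norm x)\<^sup>2 + 2 * (norm y)\<^sup>2" for x y :: "'b::real_inner"
  using zero_le_power2[of "norm (x - y)"]
  by (simp add: power2_norm_eq_inner inner_add inner_diff inner_commute)

lemma square_integrable_add:
  assumes "square_integrable M f" "square_integrable M g"
  shows "square_integrable M (\<lambda>x. f x + g x)"
proof -
  have [measurable]: "f \<in> borel_measurable M" "g \<in> borel_measurable M"
    using assms by (auto simp: square_integrable_def)
  have int: "integrable M (\<lambda>x. 2 * (norm (f x))\<^sup>2 + 2 * (norm (g x))\<^sup>2)"
    using assms by (auto simp: square_integrable_def)
  have "integrable M (\<lambda>x. (norm (f x + g x))\<^sup>2)"
    by (rule Bochner_Integration.integrable_bound[OF int]) (auto simp: norm_add_sq_le)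
  thus ?thesis by (simp add: square_integrable_def)
qed

lemma square_integrable_scaleR:
  "square_integrable M f \<Longrightarrow> square_integrable M (\<lambda>x. c *\<^sub>R f x)"
  by (auto simp: square_integrable_def power_mult_distrib)

lemma square_integrable_scaleR_left:
  fixes f :: "'a \<Rightarrow> real"
  shows "square_integrable M f \<Longrightarrow> square_integrable M (\<lambda>x. f x *\<^sub>R c)"
  by (auto simp: square_integrable_def power_mult_distrib)

lemma square_integrable_diff:
  "square_integrable M f \<Longrightarrow> square_integrable M g \<Longrightarrow> square_integrable M (\<lambda>x. f x - g x)"
  using square_integrable_add[of M f "\<lambda>x. (- 1) *\<^sub>R g x"] square_integrable_scaleR[of M g "- 1"] by simp

lemma square_integrable_sum:
  "(\<And>i. i \<in> I \<Longrightarrow> square_integrable M (f i)) \<Longrightarrow> square_integrable M (\<lambda>x. \<Sum>i\<in>I. f i x)"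
proof (induction I rule: infinite_finite_induct)
  case (insert i I)
  thus ?case using square_integrable_add[of M "f i"] by simp
qed (simp_all add: square_integrable_def)

lemma integrable_inner:
  assumes "square_integrable M f" "square_integrable M g"
  shows "integrable M (\<lambda>x. f x \<bullet> g x)"
proof -
  have [measurable]: "f \<in> borel_measurable M" "g \<in> borel_measurable M"
    using assms by (auto simp: square_integrable_def)
  have int: "integrable M (\<lambda>x. (norm (f x))\<^sup>2 + (norm (g x))\<^sup>2)"
    using assms by (auto simp: square_integrable_def)
  have "\<bar>x \<bullet> y\<bar> \<le> (norm x)\<^sup>2 + (norm y)\<^sup>2" for x y :: 'b
    using Cauchy_Schwarz_ineq2[of x y] sum_squares_bound[of "norm x" "norm y"]
      mult_nonneg_nonneg[OF norm_ge_zero[of x] norm_ge_zero[of y]] by linarith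
  thus ?thesis
    by (intro Bochner_Integration.integrable_bound[OF int]) auto
qed

lemma square_integrable_mult:
  "square_integrable M f \<Longrightarrow> square_integrable M g \<Longrightarrow> integrable M (\<lambda>x. f x * g x)" for f g :: "'a \<Rightarrow> real"
  using integrable_inner[of M f g] by simp

section \<open>Processes as functions on the product space\<close>

lemma haar_eq_0:
  assumes "T > 0" "k < 2 ^ i" "t \<notin> {0..T}"
  shows "haar T i k t = 0"
proof -
  have "cell T (Suc i) j t = 0" if "j < 2 ^ Suc i" for j
    using grid_mem[OF assms(1), of j "Suc i"] grid_mem[OF assms(1), of "Suc j" "Suc i"] that assms(3)
    by (auto simp: cell_def indicator_def)
  thus ?thesis by (simp add: haar_eq_sum_cell[OF assms(1,2) lessI] del: power_Suc)
qed

lemma haar_measurable [measurable]: "haar T i k \<in> borel_measurable borel"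
  unfolding haar_def by measurable

text \<open>Left-open intervals are those in the generators of
  \<open>predictable_sigma\<close>.\<close>

definition haar_Ioc :: "real \<Rightarrow> nat \<Rightarrow> nat \<Rightarrow> real \<Rightarrow> real" where
  "haar_Ioc T i k t = 2 powr (real i / 2) / sqrt T *
     (- indicator {T * real k / 2 ^ i <.. T * (1 + 2 * real k) / 2 ^ (i + 1)} t
      + indicator {T * (1 + 2 * real k) / 2 ^ (i + 1) <.. T * (real k + 1) / 2 ^ i} t)"

lemma AE_haar_Ioc: "AE t in lborel. haar_Ioc T i k t = haar T i k t"
proof -
  let ?B = "{T * real k / 2 ^ i, T * (1 + 2 * real k) / 2 ^ (i + 1), T * (real k + 1) / 2 ^ i}"
  have "AE t in lborel. t \<notin> ?B"
    by (rule AE_not_in[OF finite_imp_null_set_lborel]) simp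
  thus ?thesis
    by eventually_elim (auto simp: haar_Ioc_def haar_def indicator_def)
qed

lemma poly_measurable:
  "f \<in> borel_measurable M \<Longrightarrow> (\<lambda>x. poly p (f x)) \<in> borel_measurable M" for f :: "'a \<Rightarrow> real"
  by (rule measurable_compose[of f M borel])
    (auto intro!: borel_measurable_continuous_onI continuous_intros)

context brownian
begin

text \<open>The state comes first, matching the order of integration in \<open>h2_energy\<close> and
  \<open>h2_inner\<close>; predictable sets have the opposite order, hence the swap in
  \<open>uncurried\<close>.\<close>

definition time_space :: "('a \<times> real) measure" where
  "time_space = M \<Otimes>\<^sub>M restrict_space lborel {0..T}"

definition uncurried :: "(real \<Rightarrow> 'a \<Rightarrow> 'b) \<Rightarrow> 'a \<times> real \<Rightarrow> 'b" where
  "uncurried u = (\<lambda>(\<omega>, t). u t \<omega>)"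

sublocale pair: pair_sigma_finite M "restrict_space lborel {0..T}"
proof -
  have "sigma_finite_measure (restrict_space lborel {0..T})"
    by (rule sigma_finite_measure_restrict_space) (auto intro: lborel.sigma_finite_measure_axioms)
  thus "pair_sigma_finite M (restrict_space lborel {0..T})"
    by (intro pair_sigma_finite.intro sigma_finite_measure_axioms)
qed

lemma energy_eq:
  fixes u :: "real \<Rightarrow> 'a \<Rightarrow> 'b::euclidean_space"
  assumes "uncurried u \<in> borel_measurable time_space"
  shows "h2_energy M T u = (\<integral>\<^sup>+x. ennreal ((norm (uncurried u x))\<^sup>2) \<partial>time_space)"
proof -
  have [measurable]: "uncurried u \<in> borel_measurable (M \<Otimes>\<^sub>M restrict_space lborel {0..T})"
    using assms by (simp add: time_space_def)
  have "h2_energy M T u = (\<integral>\<^sup>+\<omega>. (\<integral>\<^sup>+t. ennreal ((norm (uncurried u (\<omega>, t)))\<^sup>2) \<partial>restrict_space lborel {0..T}) \<partial>M)"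
    unfolding h2_energy_def by (simp add: nn_integral_restrict_space uncurried_def)
  also have "\<dots> = (\<integral>\<^sup>+x. ennreal ((norm (uncurried u x))\<^sup>2) \<partial>time_space)"
    unfolding time_space_def by (rule pair.M2.nn_integral_fst) measurable
  finally show ?thesis .
qed

lemma square_integrable_iff_energy:
  fixes u :: "real \<Rightarrow> 'a \<Rightarrow> 'b::euclidean_space"
  assumes "uncurried u \<in> borel_measurable time_space"
  shows "square_integrable time_space (uncurried u) \<longleftrightarrow> h2_energy M T u < \<infinity>"
  using assms by (simp add: square_integrable_def integrable_iff_bounded energy_eq)

lemma h2_norm_sq:
  fixes u :: "real \<Rightarrow> 'a \<Rightarrow> 'b::euclidean_space"
  assumes "square_integrable time_space (uncurried u)"
  shows "(h2_norm M T u)\<^sup>2 = (LINT x|time_space. (norm (uncurried u x))\<^sup>2)"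
proof -
  have "h2_energy M T u = ennreal (LINT x|time_space. (norm (uncurried u x))\<^sup>2)"
    using assms by (subst energy_eq) (auto simp: square_integrable_def nn_integral_eq_integral)
  thus ?thesis by (simp add: h2_norm_def)
qed

lemma h2_inner_eq:
  assumes "square_integrable time_space (uncurried u)" "square_integrable time_space (uncurried v)"
  shows "h2_inner M T u v = (LINT x|time_space. uncurried u x * uncurried v x)"
proof -
  have "h2_inner M T u v =
      (LINT \<omega>|M. (LINT t|restrict_space lborel {0..T}. uncurried u (\<omega>, t) * uncurried v (\<omega>, t)))"
    by (simp add: h2_inner_def set_lebesgue_integral_def integral_restrict_space uncurried_def)
  also have "\<dots> = (LINT x|time_space. uncurried u x * uncurried v x)"
    unfolding time_space_def
    by (rule pair.integral_fst') (use square_integrable_mult[OF assms] in \<open>simp add: time_space_def\<close>)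
  finally show ?thesis .
qed

section \<open>Adapted and predictable measurability\<close>

lemma history_subset: "completed_history M T W s \<subseteq> sets M"
  unfolding completed_history_def
  by (rule sets.sigma_sets_subset) (auto intro: measurable_sets[OF W_measurable])

lemma filtration_generator: "(\<Inter>s\<in>{t<..}. completed_history M T W s) \<subseteq> sets M"
proof -
  have "(\<Inter>s\<in>{t<..}. completed_history M T W s) \<subseteq> completed_history M T W (t + 1)"
    by (rule INF_lower) simp
  thus ?thesis using history_subset by (rule subset_trans)
qed

lemma space_filtration [simp]: "space (brownian_filtration M T W t) = space M"
  unfolding brownian_filtration_def by (rule space_measure_of_conv)

lemma sets_filtration:
  "sets (brownian_filtration M T W t) = sigma_sets (space M) (\<Inter>s\<in>{t<..}. completed_history M T W s)"
  unfolding brownian_filtration_def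
  by (rule sets_measure_of) (rule subset_trans[OF filtration_generator sets.space_closed])

lemma filtration_subset: "sets (brownian_filtration M T W t) \<subseteq> sets M"
  unfolding sets_filtration by (rule sets.sigma_sets_subset[OF filtration_generator])

lemma W_measurable_filtration:
  assumes "0 \<le> u" "u \<le> s" "u \<le> T"
  shows "W u \<in> borel_measurable (brownian_filtration M T W s)"
proof (rule measurableI)
  fix B :: "(real ^ 'D) set" assume "B \<in> sets borel"
  hence "W u -` B \<inter> space M \<in> completed_history M T W s'" if "s' > s" for s'
    unfolding completed_history_def using assms that by (intro sigma_sets.Basic) force
  thus "W u -` B \<inter> space (brownian_filtration M T W s) \<in> sets (brownian_filtration M T W s)"
    unfolding sets_filtration space_filtration by (intro sigma_sets.Basic) blast
qed simp

lemma predictable_generators: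
  "{{0} \<times> A | A. A \<in> sets (brownian_filtration M T W 0)} \<union>
    {{s<..t} \<times> A | s t A. 0 \<le> s \<and> s < t \<and> t \<le> T \<and> A \<in> sets (brownian_filtration M T W s)}
    \<subseteq> Pow ({0..T} \<times> space M)" (is "?G \<subseteq> _")
proof
  fix R assume "R \<in> ?G"
  thus "R \<in> Pow ({0..T} \<times> space M)"
  proof (elim UnE CollectE exE conjE)
    fix A assume "R = {0} \<times> A" "A \<in> sets (brownian_filtration M T W 0)"
    thus ?thesis using sets.sets_into_space[of A "brownian_filtration M T W 0"] T_pos by auto
  next
    fix s t A assume "R = {s<..t} \<times> A" "0 \<le> s" "t \<le> T" "A \<in> sets (brownian_filtration M T W s)"
    thus ?thesis using sets.sets_into_space[of A "brownian_filtration M T W s"]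
      by (auto simp: space_filtration)
  qed
qed

lemma space_predictable [simp]: "space (predictable_sigma M T W) = {0..T} \<times> space M"
  unfolding predictable_sigma_def by (rule space_measure_of_conv)

lemma predictable_rectangle:
  assumes "0 \<le> s" "s < t" "t \<le> T" "A \<in> sets (brownian_filtration M T W s)"
  shows "{s<..t} \<times> A \<in> sets (predictable_sigma M T W)"
  unfolding predictable_sigma_def sets_measure_of[OF predictable_generators]
  by (intro sigma_sets.Basic UnI2) (use assms in blast)

text \<open>This is joint measurability of predictable processes. It suffices to look at generators,
  whose inverse images are measurable rectangles.\<close>

lemma swap_measurable: "(\<lambda>(\<omega>, t). (t, \<omega>)) \<in> measurable time_space (predictable_sigma M T W)"
  unfolding predictable_sigma_def
proof (rule measurable_measure_of[OF predictable_generators])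
  show "(\<lambda>(\<omega>, t). (t, \<omega>)) \<in> space time_space \<rightarrow> {0..T} \<times> space M"
    by (auto simp: time_space_def space_pair_measure space_restrict_space)
next
  have *: "(\<lambda>(\<omega>, t). (t, \<omega>)) -` (B \<times> A) \<inter> space time_space \<in> sets time_space"
    if "B \<subseteq> {0..T}" "B \<in> sets borel" "A \<in> sets (brownian_filtration M T W s)" for A B s
  proof -
    have A: "A \<in> sets M" using that filtration_subset by blast
    have "(\<lambda>(\<omega>, t). (t, \<omega>)) -` (B \<times> A) \<inter> space time_space = A \<times> B"
      using that(1) sets.sets_into_space[OF A] by (auto simp: time_space_def space_pair_measure space_restrict_space)
    also have "\<dots> \<in> sets time_space"
      unfolding time_space_def using A that by (intro pair_measureI) (auto simp: sets_restrict_space_iff)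
    finally show ?thesis .
  qed
  fix R assume "R \<in> {{0} \<times> A | A. A \<in> sets (brownian_filtration M T W 0)} \<union>
    {{s<..t} \<times> A | s t A. 0 \<le> s \<and> s < t \<and> t \<le> T \<and> A \<in> sets (brownian_filtration M T W s)}"
  thus "(\<lambda>(\<omega>, t). (t, \<omega>)) -` R \<inter> space time_space \<in> sets time_space"
    using T_pos by (auto intro!: * )
qed

lemma H2_square_integrable:
  fixes u :: "real \<Rightarrow> 'a \<Rightarrow> 'b::euclidean_space"
  assumes "u \<in> H2 M T W"
  shows "square_integrable time_space (uncurried u)"
proof -
  have "(\<lambda>(t, \<omega>). u t \<omega>) \<in> borel_measurable (predictable_sigma M T W)"
    using assms by (simp add: H2_def)
  from measurable_compose[OF swap_measurable this] have "uncurried u \<in> borel_measurable time_space"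
    by (simp add: uncurried_def case_prod_unfold)
  thus ?thesis using assms by (simp add: square_integrable_iff_energy H2_def)
qed

text \<open>The inverse image of \<open>B\<close> is a rectangle over the strip
  \<open>{s<..t}\<close>, together with everything off the strip if
  \<open>0 \<in> B\<close>.\<close>

lemma predictable_step:
  assumes "0 \<le> s" "s < t" "t \<le> T" and A: "A \<in> borel_measurable (brownian_filtration M T W s)"
  shows "(\<lambda>(t', \<omega>). indicator {s<..t} t' * A \<omega> :: real) \<in> borel_measurable (predictable_sigma M T W)"
proof (rule measurableI)
  let ?S = "predictable_sigma M T W"
  fix B :: "real set" assume B: "B \<in> sets borel"
  have "{s<..t} \<times> (A -` B \<inter> space M) \<in> sets ?S"
    using measurable_sets[OF A B] assms(1-3) by (intro predictable_rectangle) auto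
  moreover have "space ?S - {s<..t} \<times> space M \<in> sets ?S"
    using sets.top[of "brownian_filtration M T W s"] assms(1-3)
    by (intro sets.compl_sets predictable_rectangle) auto
  moreover have "(\<lambda>(t', \<omega>). indicator {s<..t} t' * A \<omega>) -` B \<inter> space ?S =
      {s<..t} \<times> (A -` B \<inter> space M) \<union> (if 0 \<in> B then space ?S - {s<..t} \<times> space M else {})"
    using assms(1-3) by (auto simp: indicator_def of_bool_def split: if_splits)
  ultimately show "(\<lambda>(t', \<omega>). indicator {s<..t} t' * A \<omega>) -` B \<inter> space ?S \<in> sets ?S"
    by simp
qed simp

lemma multi_indices_support:
  assumes "\<alpha> \<in> multi_indices p q"
  shows "finite (mi_support \<alpha>)" "mi_support \<alpha> \<subseteq> haar_index"
proof -
  have "mi_support \<alpha> \<subseteq> past_indices p q \<times> UNIV"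
    using assms unfolding multi_indices_def by blast
  also have "past_indices p q \<times> UNIV \<subseteq> haar_index"
    unfolding past_indices_def haar_index_def by auto
  finally show "mi_support \<alpha> \<subseteq> haar_index" .
  show "finite (mi_support \<alpha>)" using assms unfolding multi_indices_def by blast
qed

text \<open>Membership in \<open>past_indices p q\<close> says that the support of the Haar function
  ends no later than \<open>T * q / 2 ^ p\<close>, where the one with index \<open>(p, q)\<close>
  starts. Its Wiener integral is therefore known at that time.\<close>

lemma hermite_product_measurable_filtration:
  assumes "\<alpha> \<in> multi_indices p q" "q < 2 ^ p" "T * real q / 2 ^ p \<le> s"
  shows "hermite_product T W \<alpha> \<in> borel_measurable (brownian_filtration M T W s)"
  unfolding hermite_product_def
proof (intro borel_measurable_prod)
  fix x assume "x \<in> mi_support \<alpha>"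
  hence past: "x \<in> past_indices p q \<times> UNIV"
    using assms(1) unfolding multi_indices_def by blast
  obtain i k r where x1: "x = ((i, k), r)" by (metis surj_pair)
  have x: "x = ((i, k), r)" "(real k + 1) / 2 ^ i \<le> real q / 2 ^ p"
    using past unfolding x1 past_indices_def by simp_all
  have "T * ((real k + 1) / 2 ^ i) \<le> T * (real q / 2 ^ p)"
    using x(2) T_pos by (intro mult_left_mono) auto
  moreover have "real q < real (2 ^ p)" using assms(2) by (subst of_nat_less_iff)
  hence "real q / 2 ^ p \<le> 1" by simp
  hence "T * (real q / 2 ^ p) \<le> T * 1" by (rule mult_left_mono) (simp add: T_pos less_imp_le)
  ultimately have le: "T * (real k + 1) / 2 ^ i \<le> s" "T * (real k + 1) / 2 ^ i \<le> T"
    using assms(3) unfolding times_divide_eq_right by linarith+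
  have mono: "T * real k / 2 ^ i \<le> T * (real k + 1) / 2 ^ i"
      "T * (1 + 2 * real k) / 2 ^ (i + 1) \<le> T * (real k + 1) / 2 ^ i"
    using T_pos by (simp_all add: divide_simps)
  have nonneg: "0 \<le> T * real k / 2 ^ i" "0 \<le> T * (1 + 2 * real k) / 2 ^ (i + 1)"
      "0 \<le> T * (real k + 1) / 2 ^ i"
    using T_pos by simp_all
  note W =
    W_measurable_filtration[OF nonneg(1) order_trans[OF mono(1) le(1)] order_trans[OF mono(1) le(2)]]
    W_measurable_filtration[OF nonneg(2) order_trans[OF mono(2) le(1)] order_trans[OF mono(2) le(2)]]
    W_measurable_filtration[OF nonneg(3) le]
  have haar_variable: "haar_variable T W x \<in> borel_measurable (brownian_filtration M T W s)"
    unfolding x(1) haar_variable_def haar_gaussian_def[abs_def] prod.case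
    by (intro borel_measurable_times borel_measurable_add borel_measurable_diff borel_measurable_const
        measurable_compose[OF _ borel_measurable_nth] W)
  show "(\<lambda>\<omega>. normalized_hermite (\<alpha> x) (haar_variable T W x \<omega>)) \<in> borel_measurable (brownian_filtration M T W s)"
    unfolding normalized_hermite_eq_poly
    by (rule borel_measurable_divide[OF poly_measurable[OF haar_variable] borel_measurable_const])
qed

lemma haar_time_integral:
  assumes "p' < 2 ^ p"
  shows "integrable (restrict_space lborel {0..T}) (haar T p p')"
    "(LINT t|restrict_space lborel {0..T}. haar T p p' t) = 0"
proof -
  have eq: "indicator {0..T} t *\<^sub>R haar T p p' t = haar T p p' t" for t
    using haar_eq_0[OF T_pos assms] by (auto simp: indicator_def)
  show "integrable (restrict_space lborel {0..T}) (haar T p p')"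
    "(LINT t|restrict_space lborel {0..T}. haar T p p' t) = 0"
    using integrable_haar[OF T_pos assms] integral_haar[OF T_pos assms]
    by (simp_all add: integrable_restrict_space integral_restrict_space eq del: real_scaleR_def)
qed

lemma haar_mult_time_integral:
  assumes "q < 2 ^ p" "q' < 2 ^ p'"
  shows "integrable (restrict_space lborel {0..T}) (\<lambda>t. haar T p q t * haar T p' q' t)"
    "(LINT t|restrict_space lborel {0..T}. haar T p q t * haar T p' q' t) = (if (p, q) = (p', q') then 1 else 0)"
proof -
  have eq: "indicator {0..T} t *\<^sub>R (haar T p q t * haar T p' q' t) = haar T p q t * haar T p' q' t" for t
    using haar_eq_0[OF T_pos assms(1)] by (auto simp: indicator_def)
  show "integrable (restrict_space lborel {0..T}) (\<lambda>t. haar T p q t * haar T p' q' t)"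
    "(LINT t|restrict_space lborel {0..T}. haar T p q t * haar T p' q' t) = (if (p, q) = (p', q') then 1 else 0)"
    using integrable_haar_mult[OF T_pos assms] haar_orthonormal[OF T_pos assms]
    by (simp_all add: integrable_restrict_space integral_restrict_space eq del: real_scaleR_def)
qed

end

section \<open>Orthonormality of the chaoslets\<close>

context brownian
begin

lemma product_process_integrable:
  assumes "integrable M (\<lambda>\<omega>. A \<omega> * B \<omega>)" "integrable (restrict_space lborel {0..T}) (\<lambda>t. g t * h t)"
  shows "integrable time_space (\<lambda>x. uncurried (\<lambda>t \<omega>. g t * A \<omega> :: real) x * uncurried (\<lambda>t \<omega>. h t * B \<omega>) x)"
    and "(LINT x|time_space. uncurried (\<lambda>t \<omega>. g t * A \<omega> :: real) x * uncurried (\<lambda>t \<omega>. h t * B \<omega>) x) =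
      expectation (\<lambda>\<omega>. A \<omega> * B \<omega>) * (LINT t|restrict_space lborel {0..T}. g t * h t)"
proof -
  have eq: "(\<lambda>x. uncurried (\<lambda>t \<omega>. g t * A \<omega>) x * uncurried (\<lambda>t \<omega>. h t * B \<omega>) x) =
      (\<lambda>(\<omega>, t). (A \<omega> * B \<omega>) * (g t * h t))"
    by (auto simp: uncurried_def fun_eq_iff)
  show "integrable time_space (\<lambda>x. uncurried (\<lambda>t \<omega>. g t * A \<omega> :: real) x * uncurried (\<lambda>t \<omega>. h t * B \<omega>) x)"
    unfolding eq time_space_def by (rule pair.integrable_pair_mult[OF assms])
  show "(LINT x|time_space. uncurried (\<lambda>t \<omega>. g t * A \<omega> :: real) x * uncurried (\<lambda>t \<omega>. h t * B \<omega>) x) =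
      expectation (\<lambda>\<omega>. A \<omega> * B \<omega>) * (LINT t|restrict_space lborel {0..T}. g t * h t)"
    unfolding eq time_space_def by (rule pair.integral_pair_mult[OF assms])
qed

lemma product_process_square_integrable:
  assumes "has_all_moments M A" "g \<in> borel_measurable borel"
    and "integrable (restrict_space lborel {0..T}) (\<lambda>t. g t * g t)"
  shows "square_integrable time_space (uncurried (\<lambda>t \<omega>. g t * A \<omega> :: real))"
proof -
  have [measurable]: "A \<in> borel_measurable M" using assms by (simp add: has_all_moments_def)
  have [measurable]: "g \<in> borel_measurable (restrict_space lborel {0..T})"
    using assms(2) by (intro measurable_restrict_space1) simp
  have "uncurried (\<lambda>t \<omega>. g t * A \<omega>) \<in> borel_measurable time_space"
    unfolding uncurried_def time_space_def by measurable
  moreover have "integrable M (\<lambda>\<omega>. A \<omega> * A \<omega>)"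
    by (intro has_all_moments_integrable has_all_moments_mult assms)
  from product_process_integrable(1)[OF this assms(3)]
  have "integrable time_space (\<lambda>x. (norm (uncurried (\<lambda>t \<omega>. g t * A \<omega>) x))\<^sup>2)"
    by (simp add: power2_eq_square)
  ultimately show ?thesis by (simp add: square_integrable_def)
qed

lemma time_integral_const:
  "integrable (restrict_space lborel {0..T}) (\<lambda>_. c :: real)"
  "(LINT t|restrict_space lborel {0..T}. c) = T * c"
  using T_pos by (simp_all add: integrable_restrict_space measure_restrict_space)

text \<open>The constant process is given the random factor \<open>1\<close>, so that both cases are
  a function of time times a random variable.\<close>

lemma chaoslets_cases:
  assumes "m \<in> chaoslets T W k"
  obtains (chaoslet) p q \<alpha> where "q < 2 ^ p" "\<alpha> \<in> multi_indices p q" "mi_degree \<alpha> = k"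
      "m = (\<lambda>t \<omega>. haar T p q t * hermite_product T W \<alpha> \<omega>)"
  | (const) "k = 0" "m = (\<lambda>t \<omega>. 1 / sqrt T * 1)"
  using assms that unfolding chaoslets_def
  by (auto simp: chaoslet_eq[abs_def] split: if_splits)

lemma hermite_product_has_all_moments:
  "\<alpha> \<in> multi_indices p q \<Longrightarrow> has_all_moments M (hermite_product T W \<alpha>)"
  by (rule hermite_product_moments(1)[OF multi_indices_support multi_indices_support])

lemma chaoslet_square_integrable:
  assumes "m \<in> chaoslets T W k"
  shows "square_integrable time_space (uncurried m)"
  using assms
proof (cases rule: chaoslets_cases)
  case (chaoslet p q \<alpha>)
  thus ?thesis
    using product_process_square_integrable[OF hermite_product_has_all_moments haar_measurable
        haar_mult_time_integral(1)] by blast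
next
  case const
  show ?thesis unfolding const
    by (rule product_process_square_integrable[OF has_all_moments_const]) (auto intro: time_integral_const)
qed

lemma chaoslet_norm:
  assumes "m \<in> chaoslets T W k"
  shows "(LINT x|time_space. uncurried m x * uncurried m x) = 1"
  using assms
proof (cases rule: chaoslets_cases)
  case (chaoslet p q \<alpha>)
  note moments = hermite_product_moments[OF multi_indices_support[OF chaoslet(2)] multi_indices_support[OF chaoslet(2)]]
  have int: "integrable M (\<lambda>\<omega>. hermite_product T W \<alpha> \<omega> * hermite_product T W \<alpha> \<omega>)"
    by (intro has_all_moments_integrable has_all_moments_mult moments)
  show ?thesis
    unfolding chaoslet(4) product_process_integrable(2)[OF int haar_mult_time_integral(1)[OF chaoslet(1,1)]]
      moments(2) haar_mult_time_integral(2)[OF chaoslet(1,1)] by simp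
next
  case const
  have int: "integrable M (\<lambda>\<omega>. 1 * 1 :: real)" by simp
  show ?thesis
    unfolding const product_process_integrable(2)[OF int time_integral_const(1)] time_integral_const(2)
    using T_pos by (simp add: prob_space)
qed

text \<open>Two Haar chaoslets differ in the Haar function or in the multi-index, which kills the
  time integral or the expectation. Against the constant process the Haar function has mean
  0.\<close>

lemma chaoslet_orthogonal:
  assumes "m \<in> chaoslets T W k" "m' \<in> chaoslets T W k'" "(k, m) \<noteq> (k', m')"
  shows "(LINT x|time_space. uncurried m x * uncurried m' x) = 0"
proof -
  have mixed: "(LINT x|time_space. uncurried (\<lambda>t \<omega>. haar T p q t * hermite_product T W \<alpha> \<omega>) x *
      uncurried (\<lambda>t \<omega>. 1 / sqrt T * 1) x) = 0"
    if "q < 2 ^ p" "\<alpha> \<in> multi_indices p q" for p q and \<alpha> :: "(nat \<times> nat) \<times> 'D \<Rightarrow> nat"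
  proof -
    have int: "integrable M (\<lambda>\<omega>. hermite_product T W \<alpha> \<omega> * 1)"
      using has_all_moments_integrable[OF hermite_product_has_all_moments[OF that(2)]] by simp
    have int': "integrable (restrict_space lborel {0..T}) (\<lambda>t. haar T p q t * (1 / sqrt T))"
      using haar_time_integral[OF that(1)] by (intro integrable_mult_left)
    show ?thesis
      unfolding product_process_integrable(2)[OF int int']
      using haar_time_integral[OF that(1)] by simp
  qed
  show ?thesis
    using assms(1)
  proof (cases rule: chaoslets_cases)
    case c: (chaoslet p q \<alpha>)
    show ?thesis
      using assms(2)
    proof (cases rule: chaoslets_cases)
      case c': (chaoslet p' q' \<alpha>')
      note moments = hermite_product_moments[OF multi_indices_support[OF c(2)] multi_indices_support[OF c'(2)]]
        hermite_product_moments(1)[OF multi_indices_support[OF c'(2)] multi_indices_support[OF c'(2)]]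
      have int: "integrable M (\<lambda>\<omega>. hermite_product T W \<alpha> \<omega> * hermite_product T W \<alpha>' \<omega>)"
        by (intro has_all_moments_integrable has_all_moments_mult moments)
      \<comment> \<open>Equal data would give equal degrees and equal processes. The argument also
        covers one process listed under two degrees, a case which unit norm then excludes.\<close>
      have "\<not> (\<alpha> = \<alpha>' \<and> (p, q) = (p', q'))" using assms(3) c c' by auto
      thus ?thesis
        unfolding c(4) c'(4) product_process_integrable(2)[OF int haar_mult_time_integral(1)[OF c(1) c'(1)]]
          moments(2) haar_mult_time_integral(2)[OF c(1) c'(1)] by auto
    next
      case const
      thus ?thesis using mixed c by simp
    qed
  next
    case const
    show ?thesis
      using assms(2)
    proof (cases rule: chaoslets_cases)
      case c': (chaoslet p' q' \<alpha>')
      show ?thesis unfolding const c'(4) using mixed[OF c'(1,2)] by (simp add: mult.commute)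
    qed (use const assms(3) in auto)
  qed
qed

section \<open>Predictable versions of chaoslets and projections\<close>

lemma energy_cong_AE:
  assumes "\<And>\<omega>. \<omega> \<in> space M \<Longrightarrow> AE t in lborel. u t \<omega> = v t \<omega>"
  shows "h2_energy M T u = h2_energy M T v"
  unfolding h2_energy_def
proof (rule nn_integral_cong, rule nn_integral_cong_AE)
  fix \<omega> assume "\<omega> \<in> space M"
  from assms[OF this] show "AE t in lborel. ennreal ((norm (u t \<omega>))\<^sup>2) * indicator {0..T} t =
      ennreal ((norm (v t \<omega>))\<^sup>2) * indicator {0..T} t"
    by eventually_elim simp
qed

text \<open>Haar functions are right-continuous, hence chaoslets are not visibly predictable. Moving the
  jumps to left-open intervals gives a predictable process that agrees with them outside a null set.\<close>

lemma chaoslet_predictable_version: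
  assumes "m \<in> chaoslets T W k"
  obtains v where "v \<in> H2 M T W" "\<And>\<omega>. AE t in lborel. v t \<omega> = m t \<omega>"
proof -
  have fin: "h2_energy M T m < \<infinity>"
    using chaoslet_square_integrable[OF assms] square_integrable_iff_energy[OF square_integrable_measurable] by blast
  from assms show thesis
  proof (cases rule: chaoslets_cases)
    case (chaoslet p q \<alpha>)
    define A where "A = hermite_product T W \<alpha>"
    define a b c where "a = T * real q / 2 ^ p" and "b = T * (1 + 2 * real q) / 2 ^ (p + 1)"
      and "c = T * (real q + 1) / 2 ^ p"
    define v where "v = (\<lambda>t \<omega>. haar_Ioc T p q t * A \<omega>)"
    have "q + 1 \<le> 2 ^ p" using chaoslet(1) by simp
    hence "real (q + 1) \<le> real (2 ^ p)" by (rule of_nat_mono)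
    hence "real q + 1 \<le> 2 ^ p" by simp
    hence "T * (real q + 1) \<le> T * 2 ^ p" using T_pos by (intro mult_left_mono) auto
    hence "c \<le> T" unfolding c_def by (subst pos_divide_le_eq) auto
    moreover have "0 \<le> a" "a < b" "b < c" using T_pos by (simp_all add: a_def b_def c_def divide_simps)
    ultimately have abc: "0 \<le> a" "a < b" "b \<le> T" "0 \<le> b" "b < c" "c \<le> T" by auto
    have A: "A \<in> borel_measurable (brownian_filtration M T W a)" "A \<in> borel_measurable (brownian_filtration M T W b)"
      unfolding A_def
      by (rule hermite_product_measurable_filtration[OF chaoslet(2,1)], use abc(2) in \<open>simp add: a_def\<close>)+
    have v: "v t \<omega> = 2 powr (real p / 2) / sqrt T * (indicator {b<..c} t * A \<omega> - indicator {a<..b} t * A \<omega>)" for t \<omega>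
      unfolding v_def haar_Ioc_def a_def b_def c_def by (simp add: algebra_simps)
    have eq: "(case x of (t, \<omega>) \<Rightarrow> v t \<omega>) = 2 powr (real p / 2) / sqrt T *
        ((case x of (t, \<omega>) \<Rightarrow> indicator {b<..c} t * A \<omega>) - (case x of (t, \<omega>) \<Rightarrow> indicator {a<..b} t * A \<omega>))" for x
      by (cases x) (simp only: prod.case v)
    have meas: "(\<lambda>(t, \<omega>). v t \<omega>) \<in> borel_measurable (predictable_sigma M T W)"
      unfolding eq
      by (rule borel_measurable_times[OF borel_measurable_const borel_measurable_diff
            [OF predictable_step[OF abc(4-6) A(2)] predictable_step[OF abc(1-3) A(1)]]])
    have AE: "AE t in lborel. v t \<omega> = m t \<omega>" for \<omega>
      using AE_haar_Ioc[of T p q] by eventually_elim (simp add: v_def chaoslet(4) A_def)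
    have "h2_energy M T v = h2_energy M T m" by (rule energy_cong_AE) (rule AE)
    hence "v \<in> H2 M T W" using meas fin unfolding H2_def by simp
    thus thesis using AE by (rule that)
  next
    case const
    have "m \<in> H2 M T W" using fin unfolding H2_def const(2) by (simp add: case_prod_unfold)
    thus thesis by (rule that) simp
  qed
qed

lemma uncurried_diff: "uncurried (\<lambda>t \<omega>. u t \<omega> - v t \<omega>) = (\<lambda>x. uncurried u x - uncurried v x)"
  by (auto simp: uncurried_def)

text \<open>\<open>Y - J\<close> is orthogonal to the closed span. The test process is a predictable
  version \<open>v\<close> of \<open>m\<close>, which changes no integral because \<open>v\<close>
  and \<open>m\<close> agree almost everywhere.\<close>

lemma projection_coefficient:
  assumes Y: "Y \<in> H2 M T W" and proj: "is_h2_projection M T W (chaoslets T W k) Y J"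
    and m: "m \<in> chaoslets T W k"
  shows "(LINT x|time_space. uncurried J x * uncurried m x) = (LINT x|time_space. uncurried Y x * uncurried m x)"
proof -
  obtain v where v: "v \<in> H2 M T W" "\<And>\<omega>. AE t in lborel. v t \<omega> = m t \<omega>"
    using chaoslet_predictable_version[OF m] by blast
  have J: "J \<in> H2 M T W" using proj by (simp add: is_h2_projection_def h2_closed_span_def)
  note sq = H2_square_integrable[OF Y] H2_square_integrable[OF J] H2_square_integrable[OF v(1)]
    chaoslet_square_integrable[OF m]
  have "AE t in lborel. v t \<omega> - m t \<omega> = 0" for \<omega>
    using v(2)[of \<omega>] by eventually_elim simp
  hence energy: "h2_energy M T (\<lambda>t \<omega>. v t \<omega> - m t \<omega>) = 0"
    using energy_cong_AE[of "\<lambda>t \<omega>. v t \<omega> - m t \<omega>" "\<lambda>_ _. 0"] by (simp add: h2_energy_def)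
  have meas: "(\<lambda>x. uncurried v x - uncurried m x) \<in> borel_measurable time_space"
    using square_integrable_diff[OF sq(3,4)] by (rule square_integrable_measurable)
  hence [measurable]: "(\<lambda>x. uncurried v x - uncurried m x) \<in> borel_measurable time_space" .
  have "(\<integral>\<^sup>+x. ennreal ((norm (uncurried v x - uncurried m x))\<^sup>2) \<partial>time_space) = 0"
    using energy energy_eq[of "\<lambda>t \<omega>. v t \<omega> - m t \<omega>"] meas by (simp add: uncurried_diff)
  hence "AE x in time_space. ennreal ((norm (uncurried v x - uncurried m x))\<^sup>2) = 0"
    by (subst (asm) nn_integral_0_iff_AE) auto
  hence AE: "AE x in time_space. uncurried v x = uncurried m x"
    by eventually_elim (simp add: ennreal_eq_0_iff)
  \<comment> \<open>The combination consisting of \<open>m\<close> alone is at distance 0 from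
    \<open>v\<close>; the predictability demanded of the span holds for \<open>v\<close> by
    construction.\<close>
  have "v \<in> h2_closed_span M T W (chaoslets T W k)"
    unfolding h2_closed_span_def
  proof (intro CollectI conjI allI impI v(1))
    fix \<epsilon> :: real assume "\<epsilon> > 0"
    thus "\<exists>F c. finite F \<and> F \<subseteq> chaoslets T W k \<and> h2_norm M T (\<lambda>t \<omega>. v t \<omega> - (\<Sum>m\<in>F. c m * m t \<omega>)) < \<epsilon>"
      using m energy by (intro exI[of _ "{m}"] exI[of _ "\<lambda>_. 1"]) (simp add: h2_norm_def)
  qed
  hence "0 = h2_inner M T (\<lambda>t \<omega>. Y t \<omega> - J t \<omega>) v"
    using proj by (simp add: is_h2_projection_def)
  also have "\<dots> = (LINT x|time_space. (uncurried Y x - uncurried J x) * uncurried v x)"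
    using h2_inner_eq[of "\<lambda>t \<omega>. Y t \<omega> - J t \<omega>" v] square_integrable_diff[OF sq(1,2)] sq(3)
    by (simp add: uncurried_diff)
  also have "\<dots> = (LINT x|time_space. (uncurried Y x - uncurried J x) * uncurried m x)"
    using AE sq[THEN square_integrable_measurable]
    by (intro integral_cong_AE borel_measurable_times borel_measurable_diff) auto
  also have "\<dots> = (LINT x|time_space. uncurried Y x * uncurried m x) - (LINT x|time_space. uncurried J x * uncurried m x)"
    using square_integrable_mult[OF sq(1,4)] square_integrable_mult[OF sq(2,4)] by (simp add: left_diff_distrib)
  finally show ?thesis by simp
qed

end

section \<open>Orthonormal expansions\<close>

locale orthonormal_family =
  fixes Q :: "'x measure" and I :: "'i set" and \<phi> :: "'i \<Rightarrow> 'x \<Rightarrow> real"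
  assumes square_integrable: "i \<in> I \<Longrightarrow> square_integrable Q (\<phi> i)"
    and orthonormal: "i \<in> I \<Longrightarrow> j \<in> I \<Longrightarrow> (LINT x|Q. \<phi> i x * \<phi> j x) = (if i = j then 1 else 0)"
begin

lemma square_integrable_combination:
  "F \<subseteq> I \<Longrightarrow> square_integrable Q (\<lambda>x. \<Sum>i\<in>F. \<phi> i x *\<^sub>R \<beta> i)"
  by (intro square_integrable_sum square_integrable_scaleR_left square_integrable) auto

lemma norm_combination:
  fixes \<beta> :: "'i \<Rightarrow> 'b::euclidean_space"
  assumes "finite F" "F \<subseteq> I"
  shows "(LINT x|Q. (norm (\<Sum>i\<in>F. \<phi> i x *\<^sub>R \<beta> i))\<^sup>2) = (\<Sum>i\<in>F. (norm (\<beta> i))\<^sup>2)"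
proof -
  have "(LINT x|Q. (norm (\<Sum>i\<in>F. \<phi> i x *\<^sub>R \<beta> i))\<^sup>2) =
      (LINT x|Q. (\<Sum>i\<in>F. \<Sum>j\<in>F. (\<beta> j \<bullet> \<beta> i) * (\<phi> i x * \<phi> j x)))"
    by (simp add: power2_norm_eq_inner inner_sum_left inner_sum_right sum_distrib_left mult_ac)
  also have "\<dots> = (\<Sum>i\<in>F. \<Sum>j\<in>F. (\<beta> j \<bullet> \<beta> i) * (LINT x|Q. \<phi> i x * \<phi> j x))"
    using assms(2)
    by (subst Bochner_Integration.integral_sum, force intro!: Bochner_Integration.integrable_sum integrable_mult_right square_integrable_mult square_integrable,
        intro sum.cong refl, subst Bochner_Integration.integral_sum)
      (auto intro!: integrable_mult_right square_integrable_mult square_integrable)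
  also have "\<dots> = (\<Sum>i\<in>F. \<Sum>j\<in>F. if i = j then \<beta> j \<bullet> \<beta> i else 0)"
    using assms(2) by (intro sum.cong refl) (auto simp: orthonormal subset_iff)
  also have "\<dots> = (\<Sum>i\<in>F. (norm (\<beta> i))\<^sup>2)"
    using assms(1) by (simp add: power2_norm_eq_inner)
  finally show ?thesis .
qed

lemma bessel:
  fixes f :: "'x \<Rightarrow> real"
  assumes "finite F" "F \<subseteq> I" and f: "square_integrable Q f"
  shows "(\<Sum>i\<in>F. (LINT x|Q. f x * \<phi> i x)\<^sup>2) \<le> (LINT x|Q. (f x)\<^sup>2)"
proof -
  define c where "c i = (LINT x|Q. f x * \<phi> i x)" for i
  define S where "S x = (\<Sum>i\<in>F. \<phi> i x *\<^sub>R c i)" for x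
  have S: "square_integrable Q S"
    unfolding S_def by (rule square_integrable_combination[OF assms(2)])
  have "(LINT x|Q. f x * S x) = (LINT x|Q. (\<Sum>i\<in>F. c i * (f x * \<phi> i x)))"
    by (simp add: S_def sum_distrib_left mult_ac)
  also have "\<dots> = (\<Sum>i\<in>F. c i * c i)"
    using assms(2) unfolding c_def
    by (subst Bochner_Integration.integral_sum)
      (auto intro!: integrable_mult_right square_integrable_mult f square_integrable)
  finally have fS: "(LINT x|Q. f x * S x) = (\<Sum>i\<in>F. c i * c i)" .
  have SS: "(LINT x|Q. S x * S x) = (\<Sum>i\<in>F. c i * c i)"
    using norm_combination[OF assms(1,2), of c] by (simp add: S_def power2_eq_square)
  have "0 \<le> (LINT x|Q. (f x - S x)\<^sup>2)" by simp
  also have "\<dots> = (LINT x|Q. f x * f x - 2 * (f x * S x) + S x * S x)"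
    by (simp add: power2_eq_square algebra_simps)
  also have "\<dots> = (LINT x|Q. f x * f x) - 2 * (LINT x|Q. f x * S x) + (LINT x|Q. S x * S x)"
    using square_integrable_mult[OF f f] square_integrable_mult[OF f S] square_integrable_mult[OF S S]
    by simp
  finally show ?thesis unfolding fS SS by (simp add: c_def power2_eq_square)
qed

context
  fixes X :: "'x \<Rightarrow> 'b::euclidean_space" and \<beta> :: "'i \<Rightarrow> 'b"
  assumes X: "square_integrable Q X"
    and expansion: "((\<lambda>F. LINT x|Q. (norm (X x - (\<Sum>i\<in>F. \<phi> i x *\<^sub>R \<beta> i)))\<^sup>2) \<longlongrightarrow> 0) (finite_subsets_at_top I)"
begin

text \<open>Once \<open>F\<close> contains \<open>i\<close>, the residual has the same inner product
  \<open>d\<close> with \<open>\<phi> i\<close> in direction \<open>e\<close>, whatever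
  \<open>F\<close> is. Bessel's inequality for this single function bounds \<open>d^2\<close> by the
  squared norm of the residual, which tends to 0.\<close>

lemma expansion_coefficient:
  assumes i: "i \<in> I" and e: "norm e = 1"
  shows "(LINT x|Q. (X x \<bullet> e) * \<phi> i x) = \<beta> i \<bullet> e"
proof -
  define d where "d = (LINT x|Q. (X x \<bullet> e) * \<phi> i x) - \<beta> i \<bullet> e"
  define R where "R F x = X x - (\<Sum>i\<in>F. \<phi> i x *\<^sub>R \<beta> i)" for F x
  have bound: "d\<^sup>2 \<le> (LINT x|Q. (norm (R F x))\<^sup>2)" if F: "finite F" "{i} \<subseteq> F" "F \<subseteq> I" for F
  proof -
    have inner_sq: "square_integrable Q (\<lambda>x. f x \<bullet> e)" if f: "square_integrable Q f" for f :: "'x \<Rightarrow> 'b"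
    proof -
      have [measurable]: "f \<in> borel_measurable Q" using f by (rule square_integrable_measurable)
      have le: "\<bar>y \<bullet> e\<bar> \<le> norm y" for y using Cauchy_Schwarz_ineq2[of y e] e by simp
      have "integrable Q (\<lambda>x. (norm (f x))\<^sup>2)" using f by (simp add: square_integrable_def)
      hence "integrable Q (\<lambda>x. (f x \<bullet> e)\<^sup>2)"
        by (rule Bochner_Integration.integrable_bound) (auto intro!: abs_le_square_iff[THEN iffD1] le simp: le)
      thus ?thesis by (simp add: square_integrable_def)
    qed
    have R: "square_integrable Q (R F)"
      unfolding R_def by (rule square_integrable_diff[OF X square_integrable_combination[OF F(3)]])
    have "(LINT x|Q. ((\<Sum>j\<in>F. \<phi> j x *\<^sub>R \<beta> j) \<bullet> e) * \<phi> i x) =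
        (LINT x|Q. (\<Sum>j\<in>F. (\<beta> j \<bullet> e) * (\<phi> j x * \<phi> i x)))"
      by (simp add: inner_sum_left sum_distrib_left sum_distrib_right mult_ac)
    also have "\<dots> = (\<Sum>j\<in>F. (\<beta> j \<bullet> e) * (if j = i then 1 else 0))"
      using F i
      by (subst Bochner_Integration.integral_sum)
        (auto intro!: integrable_mult_right square_integrable_mult square_integrable sum.cong simp: orthonormal subset_iff)
    also have "\<dots> = \<beta> i \<bullet> e" using F by (simp add: if_distrib cong: if_cong)
    finally have coeff: "(LINT x|Q. ((\<Sum>j\<in>F. \<phi> j x *\<^sub>R \<beta> j) \<bullet> e) * \<phi> i x) = \<beta> i \<bullet> e" .
    have "(LINT x|Q. (R F x \<bullet> e) * \<phi> i x) =
        (LINT x|Q. (X x \<bullet> e) * \<phi> i x - ((\<Sum>j\<in>F. \<phi> j x *\<^sub>R \<beta> j) \<bullet> e) * \<phi> i x)"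
      by (simp add: R_def inner_diff_left left_diff_distrib)
    also have "\<dots> = d"
      unfolding d_def coeff[symmetric]
      by (intro Bochner_Integration.integral_diff square_integrable_mult inner_sq X square_integrable[OF i]
          square_integrable_combination F(3))
    finally have "d\<^sup>2 \<le> (LINT x|Q. (R F x \<bullet> e)\<^sup>2)"
      using bessel[of "{i}" "\<lambda>x. R F x \<bullet> e"] i inner_sq[OF R] by simp
    also have "\<dots> \<le> (LINT x|Q. (norm (R F x))\<^sup>2)"
      using inner_sq[OF R] R Cauchy_Schwarz_ineq2[of _ e] e
      by (intro integral_mono) (auto simp: square_integrable_def intro!: abs_le_square_iff[THEN iffD1])
    finally show ?thesis .
  qed
  have "\<forall>\<^sub>F F in finite_subsets_at_top I. d\<^sup>2 \<le> (LINT x|Q. (norm (R F x))\<^sup>2)"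
    using bound i unfolding eventually_finite_subsets_at_top by (intro exI[of _ "{i}"]) auto
  hence "d\<^sup>2 \<le> 0"
    unfolding R_def by (rule tendsto_lowerbound[OF expansion]) simp
  thus ?thesis by (simp add: d_def)
qed

text \<open>The factor 2 avoids the triangle inequality in \<open>L\<^sup>2\<close>.\<close>

lemma expansion_tail:
  assumes F0: "finite F0" "F0 \<subseteq> I"
    and tail: "\<And>F. finite F \<Longrightarrow> F0 \<subseteq> F \<Longrightarrow> F \<subseteq> I \<Longrightarrow> (\<Sum>i\<in>F - F0. (norm (\<beta> i))\<^sup>2) \<le> B"
  shows "(LINT x|Q. (norm (X x - (\<Sum>i\<in>F0. \<phi> i x *\<^sub>R \<beta> i)))\<^sup>2) \<le> 2 * B"
proof -
  define R where "R F x = X x - (\<Sum>i\<in>F. \<phi> i x *\<^sub>R \<beta> i)" for F x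
  have sq: "square_integrable Q (R F)" if "F \<subseteq> I" for F
    unfolding R_def by (rule square_integrable_diff[OF X square_integrable_combination[OF that]])
  have bound: "(LINT x|Q. (norm (R F0 x))\<^sup>2) \<le> 2 * (LINT x|Q. (norm (R F x))\<^sup>2) + 2 * B"
    if F: "finite F" "F0 \<subseteq> F" "F \<subseteq> I" for F
  proof -
    define S where "S x = (\<Sum>i\<in>F - F0. \<phi> i x *\<^sub>R \<beta> i)" for x
    have S: "square_integrable Q S"
      unfolding S_def by (rule square_integrable_combination) (use F in auto)
    have "R F0 x = R F x + S x" for x
      using sum.subset_diff[OF F(2,1), of "\<lambda>i. \<phi> i x *\<^sub>R \<beta> i"] by (simp add: R_def S_def)
    hence "(LINT x|Q. (norm (R F0 x))\<^sup>2) \<le> (LINT x|Q. 2 * (norm (R F x))\<^sup>2 + 2 * (norm (S x))\<^sup>2)"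
      using sq[OF F0(2)] sq[OF F(3)] S norm_add_sq_le
      by (intro integral_mono) (auto simp: square_integrable_def)
    also have "\<dots> = 2 * (LINT x|Q. (norm (R F x))\<^sup>2) + 2 * (LINT x|Q. (norm (S x))\<^sup>2)"
      using sq[OF F(3)] S by (simp add: square_integrable_def)
    also have "(LINT x|Q. (norm (S x))\<^sup>2) = (\<Sum>i\<in>F - F0. (norm (\<beta> i))\<^sup>2)"
      unfolding S_def by (rule norm_combination) (use F in auto)
    finally show ?thesis using tail[OF F] by simp
  qed
  have "\<forall>\<^sub>F F in finite_subsets_at_top I.
      (LINT x|Q. (norm (R F0 x))\<^sup>2) \<le> 2 * (LINT x|Q. (norm (R F x))\<^sup>2) + 2 * B"
    using bound F0 unfolding eventually_finite_subsets_at_top by (intro exI[of _ F0]) auto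
  moreover have "((\<lambda>F. 2 * (LINT x|Q. (norm (R F x))\<^sup>2) + 2 * B) \<longlongrightarrow> 2 * 0 + 2 * B) (finite_subsets_at_top I)"
    unfolding R_def by (intro tendsto_intros expansion)
  ultimately have "(LINT x|Q. (norm (R F0 x))\<^sup>2) \<le> 2 * 0 + 2 * B"
    by (intro tendsto_lowerbound) auto
  thus ?thesis by (simp add: R_def)
qed

end

end

section \<open>Rate of approximation\<close>

text \<open>Comparison with the integral, in telescoping form: on each unit interval the mean value
  theorem writes the increment of the antiderivative as a power at an intermediate point, which
  dominates the power at the right end.\<close>

lemma powr_tail_sum_interval:
  fixes a :: real
  assumes "a > 1" "N \<ge> 1" "N \<le> n"
  shows "(\<Sum>r\<in>{N<..n}. real r powr (- a)) \<le> (real N powr (1 - a) - real n powr (1 - a)) / (a - 1)"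
  using assms(3)
proof (induction n rule: dec_induct)
  case (step n)
  have "n \<ge> 1" using assms(2) step by simp
  have "\<exists>z. real n < z \<and> z < real (Suc n) \<and>
      real (Suc n) powr (1 - a) - real n powr (1 - a) = (real (Suc n) - real n) * ((1 - a) * z powr (- a))"
  proof (rule MVT2)
    fix x assume "real n \<le> x"
    hence "x > 0" using \<open>n \<ge> 1\<close> by simp
    from has_real_derivative_powr[OF this, of "1 - a"]
    show "((\<lambda>x. x powr (1 - a)) has_real_derivative (1 - a) * x powr (- a)) (at x)" by simp
  qed simp
  then obtain z where z: "real n < z" "z < real (Suc n)"
      "real (Suc n) powr (1 - a) - real n powr (1 - a) = (1 - a) * z powr (- a)" by auto
  have "real (Suc n) powr (- a) \<le> z powr (- a)"
    using z \<open>n \<ge> 1\<close> assms(1) by (intro powr_mono2') auto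
  also have "z powr (- a) = (real n powr (1 - a) - real (Suc n) powr (1 - a)) / (a - 1)"
    using z(3) assms(1) by (simp add: field_simps)
  finally have "real (Suc n) powr (- a) \<le> (real n powr (1 - a) - real (Suc n) powr (1 - a)) / (a - 1)" .
  moreover have "{N<..Suc n} = insert (Suc n) {N<..n}" using step by auto
  ultimately show ?case using step.IH by (simp add: diff_divide_distrib)
qed simp

lemma powr_tail_sum:
  fixes a :: real
  assumes "a > 1" "N \<ge> 1" "finite R" "R \<subseteq> {N<..}"
  shows "(\<Sum>r\<in>R. real r powr (- a)) \<le> real N powr (1 - a) / (a - 1)"
proof -
  define n where "n = Max (insert N R)"
  have n: "N \<le> n" "R \<subseteq> {N<..n}" using assms(3,4) by (auto simp: n_def)
  have "(\<Sum>r\<in>R. real r powr (- a)) \<le> (\<Sum>r\<in>{N<..n}. real r powr (- a))"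
    using n by (intro sum_mono2) auto
  also have "\<dots> \<le> (real N powr (1 - a) - real n powr (1 - a)) / (a - 1)"
    by (rule powr_tail_sum_interval[OF assms(1,2) n(1)])
  also have "\<dots> \<le> real N powr (1 - a) / (a - 1)"
    using assms(1) by (intro divide_right_mono) auto
  finally show ?thesis .
qed

text \<open>Beyond \<open>P\<close> the weight is at least \<open>(1 + P) powr s\<close>, so each
  term is at most its weighted version divided by this value.\<close>

lemma weighted_tail_sum:
  fixes f :: "nat \<Rightarrow> real"
  assumes "s > 0" "\<And>k. f k \<ge> 0" "summable (\<lambda>k. (1 + real k) powr s * f k)" "finite K" "K \<subseteq> {P<..}"
  shows "(\<Sum>k\<in>K. f k) \<le> (1 + real P) powr (- s) * (\<Sum>k. (1 + real k) powr s * f k)"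
proof -
  have "(\<Sum>k\<in>K. f k) \<le> (\<Sum>k\<in>K. (1 + real P) powr (- s) * ((1 + real k) powr s * f k))"
  proof (rule sum_mono)
    fix k assume "k \<in> K"
    hence "(1 + real P) powr s \<le> (1 + real k) powr s" using assms(1,5) by (intro powr_mono2) auto
    hence "1 \<le> (1 + real P) powr (- s) * (1 + real k) powr s"
      by (simp add: powr_minus divide_simps)
    from mult_right_mono[OF this assms(2)[of k]]
    show "f k \<le> (1 + real P) powr (- s) * ((1 + real k) powr s * f k)" by (simp add: mult.assoc)
  qed
  also have "\<dots> = (1 + real P) powr (- s) * (\<Sum>k\<in>K. (1 + real k) powr s * f k)"
    by (simp add: sum_distrib_left)
  also have "\<dots> \<le> (1 + real P) powr (- s) * (\<Sum>k. (1 + real k) powr s * f k)"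
    using assms by (intro mult_left_mono sum_le_suminf) auto
  finally show ?thesis .
qed

section \<open>The two tails of the chaoslet expansion\<close>

context brownian
begin

definition chaoslet_index :: "(nat \<times> (real \<Rightarrow> 'a \<Rightarrow> real)) set" where
  "chaoslet_index = (SIGMA k:UNIV. chaoslets T W k)"

sublocale chaos: orthonormal_family time_space chaoslet_index "\<lambda>x. uncurried (snd x)"
proof
  fix x :: "nat \<times> (real \<Rightarrow> 'a \<Rightarrow> real)" assume x: "x \<in> chaoslet_index"
  thus "square_integrable time_space (uncurried (snd x))"
    by (auto simp: chaoslet_index_def intro: chaoslet_square_integrable)
  fix y :: "nat \<times> (real \<Rightarrow> 'a \<Rightarrow> real)" assume y: "y \<in> chaoslet_index"
  show "(LINT z|time_space. uncurried (snd x) z * uncurried (snd y) z) = (if x = y then 1 else 0)"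
  proof (cases "x = y")
    case True
    thus ?thesis using x chaoslet_norm[of "snd x" "fst x"] by (auto simp: chaoslet_index_def)
  next
    case False
    have "snd x \<in> chaoslets T W (fst x)" "snd y \<in> chaoslets T W (fst y)"
      using x y by (auto simp: chaoslet_index_def)
    thus ?thesis using False chaoslet_orthogonal[of "snd x" "fst x" "snd y" "fst y"] by simp
  qed
qed

lemma uncurried_residual:
  "uncurried (\<lambda>t \<omega>. X t \<omega> - (\<Sum>(k, m)\<in>F. m t \<omega> *\<^sub>R \<beta> (k, m))) =
    (\<lambda>z. uncurried X z - (\<Sum>x\<in>F. uncurried (snd x) z *\<^sub>R \<beta> x))"
  by (auto simp: uncurried_def case_prod_unfold)

lemma residual_norm_sq:
  fixes X :: "real \<Rightarrow> 'a \<Rightarrow> real ^ 'd"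
  assumes "X \<in> H2 M T W" "F \<subseteq> chaoslet_index"
  shows "(h2_norm M T (\<lambda>t \<omega>. X t \<omega> - (\<Sum>(k, m)\<in>F. m t \<omega> *\<^sub>R \<beta> (k, m))))\<^sup>2 =
    (LINT z|time_space. (norm (uncurried X z - (\<Sum>x\<in>F. uncurried (snd x) z *\<^sub>R \<beta> x)))\<^sup>2)"
  using square_integrable_diff[OF H2_square_integrable[OF assms(1)] chaos.square_integrable_combination[OF assms(2), of \<beta>]]
  by (subst h2_norm_sq) (simp_all add: uncurried_residual)

lemma expansion_tendsto:
  fixes X :: "real \<Rightarrow> 'a \<Rightarrow> real ^ 'd"
  assumes "X \<in> H2 M T W" "has_chaoslet_expansion M T W X \<beta>"
  shows "((\<lambda>F. LINT z|time_space. (norm (uncurried X z - (\<Sum>x\<in>F. uncurried (snd x) z *\<^sub>R \<beta> x)))\<^sup>2) \<longlongrightarrow> 0)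
    (finite_subsets_at_top chaoslet_index)"
proof -
  have "((\<lambda>F. (h2_norm M T (\<lambda>t \<omega>. X t \<omega> - (\<Sum>(k, m)\<in>F. m t \<omega> *\<^sub>R \<beta> (k, m))))\<^sup>2) \<longlongrightarrow> 0\<^sup>2)
      (finite_subsets_at_top chaoslet_index)"
    using assms(2) unfolding has_chaoslet_expansion_def chaoslet_index_def by (rule tendsto_power)
  moreover have "\<forall>\<^sub>F F in finite_subsets_at_top chaoslet_index. F \<subseteq> chaoslet_index"
    by (rule eventually_finite_subsets_at_top_weakI)
  hence "\<forall>\<^sub>F F in finite_subsets_at_top chaoslet_index.
      (h2_norm M T (\<lambda>t \<omega>. X t \<omega> - (\<Sum>(k, m)\<in>F. m t \<omega> *\<^sub>R \<beta> (k, m))))\<^sup>2 =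
      (LINT z|time_space. (norm (uncurried X z - (\<Sum>x\<in>F. uncurried (snd x) z *\<^sub>R \<beta> x)))\<^sup>2)"
    by (rule eventually_mono) (rule residual_norm_sq[OF assms(1)])
  ultimately show ?thesis unfolding zero_power2 by (rule Lim_transform_eventually)
qed

text \<open>Component \<open>j\<close> of \<open>X\<close> and its projection \<open>J\<close> have
  the same inner products with the chaoslets of degree \<open>k\<close>, namely the coordinates of
  \<open>\<beta>\<close>. Applying Bessel's inequality to \<open>J\<close> instead of
  \<open>X\<close> keeps the bound specific to the degree.\<close>

lemma projection_bessel:
  fixes X :: "real \<Rightarrow> 'a \<Rightarrow> real ^ 'd"
  assumes X: "X \<in> H2 M T W" "has_chaoslet_expansion M T W X \<beta>"
    and Xj: "(\<lambda>t \<omega>. X t \<omega> $ j) \<in> H2 M T W"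
    and J: "is_h2_projection M T W (chaoslets T W k) (\<lambda>t \<omega>. X t \<omega> $ j) J"
    and F: "finite F" "F \<subseteq> chaoslet_index" "\<And>x. x \<in> F \<Longrightarrow> fst x = k"
  shows "(\<Sum>x\<in>F. (\<beta> x $ j)\<^sup>2) \<le> (h2_norm M T J)\<^sup>2"
proof -
  have "J \<in> H2 M T W" using J by (simp add: is_h2_projection_def h2_closed_span_def)
  note sqJ = H2_square_integrable[OF this]
  have coeff: "\<beta> x $ j = (LINT z|time_space. uncurried J z * uncurried (snd x) z)" if x: "x \<in> F" for x
  proof -
    have xI: "x \<in> chaoslet_index" and m: "snd x \<in> chaoslets T W k"
      using F(2,3) x by (auto simp: chaoslet_index_def)
    have "\<beta> x $ j = \<beta> x \<bullet> axis j 1" by (simp add: inner_axis)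
    also have "\<dots> = (LINT z|time_space. (uncurried X z \<bullet> axis j 1) * uncurried (snd x) z)"
      by (rule chaos.expansion_coefficient[OF H2_square_integrable[OF X(1)] expansion_tendsto[OF X] xI, symmetric])
        simp
    also have "\<dots> = (LINT z|time_space. uncurried (\<lambda>t \<omega>. X t \<omega> $ j) z * uncurried (snd x) z)"
      unfolding uncurried_def case_prod_unfold inner_axis by simp
    also have "\<dots> = (LINT z|time_space. uncurried J z * uncurried (snd x) z)"
      by (rule projection_coefficient[OF Xj J m, symmetric])
    finally show ?thesis .
  qed
  have "(\<Sum>x\<in>F. (\<beta> x $ j)\<^sup>2) = (\<Sum>x\<in>F. (LINT z|time_space. uncurried J z * uncurried (snd x) z)\<^sup>2)"
    by (intro sum.cong refl) (simp add: coeff)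
  also have "\<dots> \<le> (LINT z|time_space. (uncurried J z)\<^sup>2)"
    by (rule chaos.bessel[OF F(1,2) sqJ])
  also have "\<dots> = (h2_norm M T J)\<^sup>2" by (simp add: h2_norm_sq[OF sqJ])
  finally show ?thesis .
qed

text \<open>\<open>B\<close> is the squared Sobolev norm summed over the components, hence
  independent of \<open>F\<close> and \<open>P\<close>. For each component, \<open>F\<close> is
  grouped by degree, so that every group is controlled by one projection.\<close>

lemma high_degree_tail:
  fixes X :: "real \<Rightarrow> 'a \<Rightarrow> real ^ 'd"
  assumes X: "X \<in> H2 M T W" "has_chaoslet_expansion M T W X \<beta>"
    and "s > 0" "X \<in> malliavin_sobolev_vec M T W s"
  obtains B where "B \<ge> 0" "\<And>F P. finite F \<Longrightarrow> F \<subseteq> chaoslet_index \<Longrightarrow> (\<forall>x\<in>F. P < fst x) \<Longrightarrow>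
    (\<Sum>x\<in>F. (norm (\<beta> x))\<^sup>2) \<le> B * (1 + real P) powr (- s)"
proof -
  have "\<forall>j. \<exists>J. (\<lambda>t \<omega>. X t \<omega> $ j) \<in> H2 M T W \<and>
      (\<forall>k. is_h2_projection M T W (chaoslets T W k) (\<lambda>t \<omega>. X t \<omega> $ j) (J k)) \<and>
      summable (\<lambda>k. (1 + real k) powr s * (h2_norm M T (J k))\<^sup>2)"
    using assms(4) unfolding malliavin_sobolev_vec_def malliavin_sobolev_def mem_Collect_eq by blast
  from choice[OF this] obtain J where J: "\<And>j. (\<lambda>t \<omega>. X t \<omega> $ j) \<in> H2 M T W"
      "\<And>j k. is_h2_projection M T W (chaoslets T W k) (\<lambda>t \<omega>. X t \<omega> $ j) (J j k)"
      "\<And>j. summable (\<lambda>k. (1 + real k) powr s * (h2_norm M T (J j k))\<^sup>2)"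
    by blast
  define B where "B = (\<Sum>j\<in>UNIV. \<Sum>k. (1 + real k) powr s * (h2_norm M T (J j k))\<^sup>2)"
  show thesis
  proof (rule that[of B])
    show "B \<ge> 0" unfolding B_def by (intro sum_nonneg suminf_nonneg J(3)) auto
    fix F P assume F: "finite F" "F \<subseteq> chaoslet_index" "\<forall>x\<in>F. P < fst x"
    have "(\<Sum>x\<in>F. (norm (\<beta> x))\<^sup>2) = (\<Sum>x\<in>F. \<Sum>j\<in>UNIV. (\<beta> x $ j)\<^sup>2)"
      by (simp add: norm_vec_def L2_set_def sum_nonneg)
    also have "\<dots> = (\<Sum>j\<in>UNIV. \<Sum>x\<in>F. (\<beta> x $ j)\<^sup>2)" by (rule sum.swap)
    also have "\<dots> \<le> (\<Sum>j\<in>UNIV. (1 + real P) powr (- s) * (\<Sum>k. (1 + real k) powr s * (h2_norm M T (J j k))\<^sup>2))"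
    proof (rule sum_mono)
      fix j
      have "(\<Sum>x\<in>F. (\<beta> x $ j)\<^sup>2) = (\<Sum>k\<in>fst ` F. \<Sum>x\<in>{x \<in> F. fst x = k}. (\<beta> x $ j)\<^sup>2)"
        by (rule sum.image_gen[OF F(1)])
      also have "\<dots> \<le> (\<Sum>k\<in>fst ` F. (h2_norm M T (J j k))\<^sup>2)"
        by (rule sum_mono, rule projection_bessel[OF X J(1,2)]) (use F in auto)
      also have "\<dots> \<le> (1 + real P) powr (- s) * (\<Sum>k. (1 + real k) powr s * (h2_norm M T (J j k))\<^sup>2)"
        by (rule weighted_tail_sum[OF assms(3) _ J(3)]) (use F in auto)
      finally show "(\<Sum>x\<in>F. (\<beta> x $ j)\<^sup>2) \<le>
        (1 + real P) powr (- s) * (\<Sum>k. (1 + real k) powr s * (h2_norm M T (J j k))\<^sup>2)" .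
    qed
    also have "\<dots> = B * (1 + real P) powr (- s)"
      by (simp add: B_def sum_distrib_left sum_distrib_right mult.commute)
    finally show "(\<Sum>x\<in>F. (norm (\<beta> x))\<^sup>2) \<le> B * (1 + real P) powr (- s)" .
  qed
qed

section \<open>Construction of the approximants\<close>

lemma const_chaoslet: "(\<lambda>t \<omega>. 1 / sqrt T) \<in> chaoslets T W 0"
  by (simp add: chaoslets_def)

lemma approximation_rate:
  fixes X :: "real \<Rightarrow> 'a \<Rightarrow> real ^ 'd"
  assumes S: "S > 1 / 2" and s: "s > 0"
    and X: "X \<in> H2 M T W" and compressible: "compressible M T W S X"
    and sobolev: "X \<in> malliavin_sobolev_vec M T W s"
  shows "\<exists>C>0. \<forall>N\<ge>1. \<forall>P::nat. \<exists>(m :: nat \<Rightarrow> real \<Rightarrow> 'a \<Rightarrow> real) (\<beta> :: nat \<Rightarrow> real ^ 'd).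
    (\<forall>n\<in>{1..N}. m n \<in> (\<Union>j\<in>{0..P}. chaoslets T W j)) \<and>
    h2_norm M T (\<lambda>t \<omega>. X t \<omega> - (\<Sum>n=1..N. m n t \<omega> *\<^sub>R \<beta> n))
      \<le> C * (real N powr (- (S - 1 / 2)) + (1 + real P) powr (- s / 2))"
proof -
  obtain \<beta> b C where expansion: "has_chaoslet_expansion M T W X \<beta>"
    and rearr: "is_nonincreasing_rearrangement b (\<lambda>x. norm (\<beta> x)) chaoslet_index"
    and C: "C > 0" "\<And>r. r \<ge> 1 \<Longrightarrow> b r \<le> C * real r powr (- S)"
    using compressible unfolding compressible_def chaoslet_index_def by blast
  obtain \<sigma> where \<sigma>: "inj_on \<sigma> {1..}" "\<sigma> ` {1..} \<subseteq> chaoslet_index" "\<And>r. r \<ge> 1 \<Longrightarrow> b r = norm (\<beta> (\<sigma> r))"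
      "\<And>x. x \<in> chaoslet_index - \<sigma> ` {1..} \<Longrightarrow> norm (\<beta> x) = 0"
    using rearr unfolding is_nonincreasing_rearrangement_def by blast
  obtain B where B: "B \<ge> 0" "\<And>F P. finite F \<Longrightarrow> F \<subseteq> chaoslet_index \<Longrightarrow> (\<forall>x\<in>F. P < fst x) \<Longrightarrow>
      (\<Sum>x\<in>F. (norm (\<beta> x))\<^sup>2) \<le> B * (1 + real P) powr (- s)"
    using high_degree_tail[OF X expansion s sobolev] by blast
  \<comment> \<open>The tail of the squares of \<open>C * r powr (- S)\<close>, by
    \<open>powr_tail_sum\<close> with exponent \<open>2 * S > 1\<close>.\<close>
  define A where "A = C\<^sup>2 / (2 * S - 1)"
  have A: "A \<ge> 0" using S by (simp add: A_def)
  have small: "(\<Sum>x\<in>F. (norm (\<beta> x))\<^sup>2) \<le> A * real N powr (1 - 2 * S)"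
    if F: "finite F" "F \<subseteq> chaoslet_index" "F \<inter> \<sigma> ` {1..N} = {}" and N: "N \<ge> 1" for F N
  proof -
    \<comment> \<open>The ranks occurring in \<open>F\<close>. They exceed \<open>N\<close> since
      \<open>F\<close> avoids the \<open>N\<close> largest members, and members of \<open>F\<close>
      without a rank have coefficient 0.\<close>
    define R where "R = {r. 1 \<le> r \<and> \<sigma> r \<in> F}"
    have inj: "inj_on \<sigma> R" by (rule inj_on_subset[OF \<sigma>(1)]) (auto simp: R_def)
    have R: "finite R" using F(1) by (rule inj_on_finite[OF inj, rotated]) (auto simp: R_def)
    have "R \<subseteq> {N<..}" using F(3) unfolding R_def by (auto simp: not_le[symmetric])
    have "norm (\<beta> x) = 0" if "x \<in> F - \<sigma> ` R" for x
    proof (rule \<sigma>(4))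
      show "x \<in> chaoslet_index - \<sigma> ` {1..}" using that F(2) by (auto simp: R_def)
    qed
    hence "(\<Sum>x\<in>F. (norm (\<beta> x))\<^sup>2) = (\<Sum>x\<in>\<sigma> ` R. (norm (\<beta> x))\<^sup>2)"
      using F(1) by (intro sum.mono_neutral_right) (auto simp: R_def)
    also have "\<dots> = (\<Sum>r\<in>R. (norm (\<beta> (\<sigma> r)))\<^sup>2)"
      by (subst sum.reindex[OF inj]) simp
    also have "\<dots> \<le> (\<Sum>r\<in>R. C\<^sup>2 * real r powr (- (2 * S)))"
    proof (rule sum_mono)
      fix r assume "r \<in> R"
      hence "r \<ge> 1" by (simp add: R_def)
      hence "(norm (\<beta> (\<sigma> r)))\<^sup>2 \<le> (C * real r powr (- S))\<^sup>2"
        using C(2)[of r] \<sigma>(3)[of r] by (intro power_mono) auto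
      also have "\<dots> = C\<^sup>2 * real r powr (- (2 * S))"
        by (simp add: power2_eq_square power_mult_distrib flip: powr_add)
      finally show "(norm (\<beta> (\<sigma> r)))\<^sup>2 \<le> C\<^sup>2 * real r powr (- (2 * S))" .
    qed
    also have "\<dots> = C\<^sup>2 * (\<Sum>r\<in>R. real r powr (- (2 * S)))" by (simp add: sum_distrib_left)
    also have "\<dots> \<le> C\<^sup>2 * (real N powr (1 - 2 * S) / (2 * S - 1))"
      using S N R \<open>R \<subseteq> {N<..}\<close> by (intro mult_left_mono powr_tail_sum) auto
    finally show ?thesis by (simp add: A_def)
  qed
  \<comment> \<open>The factors 2 come from \<open>expansion_tail\<close>, the roots from passing to
    the norm; the summand 1 makes \<open>K\<close> positive.\<close>
  define K where "K = sqrt (2 * A) + sqrt (2 * B) + 1"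
  have K: "K > 0" "sqrt (2 * A) \<le> K" "sqrt (2 * B) \<le> K" using A B(1) by (auto simp: K_def add_nonneg_pos)
  show ?thesis
  proof (intro exI[of _ K] conjI K(1) allI impI)
    fix N P :: nat assume N: "N \<ge> 1"
    define G where "G = {n \<in> {1..N}. fst (\<sigma> n) \<le> P}"
    define F0 where "F0 = \<sigma> ` G"
    have F0: "finite F0" "F0 \<subseteq> chaoslet_index" using \<sigma>(2) by (auto simp: F0_def G_def)
    have inj: "inj_on \<sigma> G" by (rule inj_on_subset[OF \<sigma>(1)]) (auto simp: G_def)
    \<comment> \<open>Exactly \<open>N\<close> terms are required, so ranks of too high degree are
      filled with the constant process. Its degree 0 is admissible for every \<open>P\<close>, and
      its coefficient is set to 0.\<close>
    define m where "m n = (if n \<in> G then snd (\<sigma> n) else (\<lambda>t \<omega>. 1 / sqrt T))" for n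
    define \<gamma> where "\<gamma> n = (if n \<in> G then \<beta> (\<sigma> n) else 0)" for n
    have m: "m n \<in> (\<Union>j\<in>{0..P}. chaoslets T W j)" if "n \<in> {1..N}" for n
    proof (cases "n \<in> G")
      case True
      hence "\<sigma> n \<in> chaoslet_index" using \<sigma>(2) by (auto simp: G_def)
      hence "snd (\<sigma> n) \<in> chaoslets T W (fst (\<sigma> n))" by (auto simp: chaoslet_index_def)
      thus ?thesis using True by (auto simp: m_def G_def)
    next
      case False
      thus ?thesis using const_chaoslet by (auto simp: m_def)
    qed
    have sum: "(\<Sum>n=1..N. m n t \<omega> *\<^sub>R \<gamma> n) = (\<Sum>(k, m)\<in>F0. m t \<omega> *\<^sub>R \<beta> (k, m))" for t \<omega>
    proof -
      have "(\<Sum>n=1..N. m n t \<omega> *\<^sub>R \<gamma> n) = (\<Sum>n\<in>G. snd (\<sigma> n) t \<omega> *\<^sub>R \<beta> (\<sigma> n))"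
        by (intro sum.mono_neutral_cong_right) (auto simp: G_def m_def \<gamma>_def)
      thus ?thesis unfolding F0_def by (subst sum.reindex[OF inj]) (simp add: case_prod_unfold)
    qed
    define E where "E = A * real N powr (1 - 2 * S) + B * (1 + real P) powr (- s)"
    have tail: "(\<Sum>x\<in>F - F0. (norm (\<beta> x))\<^sup>2) \<le> E" if F: "finite F" "F \<subseteq> chaoslet_index" for F
    proof -
      \<comment> \<open>Degrees above \<open>P\<close> are left to the Sobolev bound. What remains
        outside \<open>F0\<close> has degree at most \<open>P\<close>, hence is not among the
        \<open>N\<close> largest, and falls under \<open>small\<close>.\<close>
      define H where "H = {x \<in> F - F0. P < fst x}"
      have "(\<Sum>x\<in>F - F0. (norm (\<beta> x))\<^sup>2) = (\<Sum>x\<in>F - F0 - H. (norm (\<beta> x))\<^sup>2) + (\<Sum>x\<in>H. (norm (\<beta> x))\<^sup>2)"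
        using F(1) by (intro sum.subset_diff) (auto simp: H_def)
      moreover have "(\<Sum>x\<in>F - F0 - H. (norm (\<beta> x))\<^sup>2) \<le> A * real N powr (1 - 2 * S)"
        using F N by (intro small) (auto simp: H_def F0_def G_def)
      moreover have "(\<Sum>x\<in>H. (norm (\<beta> x))\<^sup>2) \<le> B * (1 + real P) powr (- s)"
        using F by (intro B(2)) (auto simp: H_def)
      ultimately show ?thesis unfolding E_def by linarith
    qed
    have "(h2_norm M T (\<lambda>t \<omega>. X t \<omega> - (\<Sum>n=1..N. m n t \<omega> *\<^sub>R \<gamma> n)))\<^sup>2 \<le> 2 * E"
      unfolding sum residual_norm_sq[OF X F0(2)]
      by (rule chaos.expansion_tail[OF H2_square_integrable[OF X] expansion_tendsto[OF X expansion] F0])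
        (rule tail)
    hence "h2_norm M T (\<lambda>t \<omega>. X t \<omega> - (\<Sum>n=1..N. m n t \<omega> *\<^sub>R \<gamma> n)) \<le> sqrt (2 * E)"
      by (rule real_le_rsqrt)
    also have "\<dots> \<le> sqrt (2 * A * real N powr (1 - 2 * S)) + sqrt (2 * B * (1 + real P) powr (- s))"
      unfolding E_def distrib_left mult.assoc[symmetric] using A B(1) by (intro sqrt_add_le_add_sqrt) auto
    also have "\<dots> = sqrt (2 * A) * real N powr (- (S - 1 / 2)) + sqrt (2 * B) * (1 + real P) powr (- s / 2)"
    proof -
      have sqrt: "sqrt (x powr y) = x powr (y / 2)" for x y :: real
        by (simp add: powr_powr flip: powr_half_sqrt)
      have "(1 - 2 * S) / 2 = - (S - 1 / 2)" by (simp add: diff_divide_distrib)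
      thus ?thesis by (simp only: real_sqrt_mult[of "2 * A"] real_sqrt_mult[of "2 * B"] sqrt)
    qed
    also have "\<dots> \<le> K * real N powr (- (S - 1 / 2)) + K * (1 + real P) powr (- s / 2)"
      by (intro add_mono mult_right_mono K) auto
    finally have "h2_norm M T (\<lambda>t \<omega>. X t \<omega> - (\<Sum>n=1..N. m n t \<omega> *\<^sub>R \<gamma> n)) \<le>
        K * (real N powr (- (S - 1 / 2)) + (1 + real P) powr (- s / 2))"
      by (simp add: distrib_left)
    moreover have "\<forall>n\<in>{1..N}. m n \<in> (\<Union>j\<in>{0..P}. chaoslets T W j)" using m by (rule ballI)
    ultimately show "\<exists>m \<beta>. (\<forall>n\<in>{1..N}. m n \<in> (\<Union>j\<in>{0..P}. chaoslets T W j)) \<and>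
        h2_norm M T (\<lambda>t \<omega>. X t \<omega> - (\<Sum>n=1..N. m n t \<omega> *\<^sub>R \<beta> n))
        \<le> K * (real N powr (- (S - 1 / 2)) + (1 + real P) powr (- s / 2))"
      by (intro exI conjI)
  qed
qed

end

theorem proposition2p2:
  fixes M :: "'a measure"
    and T S s :: real
    and W :: "real \<Rightarrow> 'a \<Rightarrow> real ^ 'D"
    and X :: "real \<Rightarrow> 'a \<Rightarrow> real ^ 'd"
  assumes "prob_space M"
    and "complete_measure M"
    and "T > 0"
    and "brownian_motion M T W"
    and "S > 1 / 2"
    and "s > 0"
    and "X \<in> H2 M T W"
    and "compressible M T W S X"
    and "X \<in> malliavin_sobolev_vec M T W s"
  shows "\<exists>C>0. \<forall>N\<ge>1. \<forall>P::nat.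
    Inf {h2_norm M T (\<lambda>t \<omega>. X t \<omega> - (\<Sum>n=1..N. m n t \<omega> *\<^sub>R \<beta> n)) |
           (m :: nat \<Rightarrow> real \<Rightarrow> 'a \<Rightarrow> real) (\<beta> :: nat \<Rightarrow> real ^ 'd).
           \<forall>n\<in>{1..N}. m n \<in> (\<Union>j\<in>{0..P}. chaoslets T W j)}
      \<le> C * (real N powr (- (S - 1 / 2)) + (1 + real P) powr (- s / 2))"
proof -
  interpret brownian M T W
    using assms(1,3,4) by (intro brownian.intro brownian_axioms.intro)
  obtain C where C: "C > 0" "\<And>N P. N \<ge> 1 \<Longrightarrow> \<exists>(m :: nat \<Rightarrow> real \<Rightarrow> 'a \<Rightarrow> real) (\<beta> :: nat \<Rightarrow> real ^ 'd).
      (\<forall>n\<in>{1..N}. m n \<in> (\<Union>j\<in>{0..P}. chaoslets T W j)) \<and>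
      h2_norm M T (\<lambda>t \<omega>. X t \<omega> - (\<Sum>n=1..N. m n t \<omega> *\<^sub>R \<beta> n))
        \<le> C * (real N powr (- (S - 1 / 2)) + (1 + real P) powr (- s / 2))"
    using approximation_rate[OF assms(5-9)] by (elim exE conjE) simp
  show ?thesis
  proof (intro exI[of _ C] conjI C(1) allI impI)
    fix N P :: nat assume "N \<ge> 1"
    from C(2)[OF this, of P] obtain m \<beta> where
      m: "\<forall>n\<in>{1..N}. m n \<in> (\<Union>j\<in>{0..P}. chaoslets T W j)" and
      bound: "h2_norm M T (\<lambda>t \<omega>. X t \<omega> - (\<Sum>n=1..N. m n t \<omega> *\<^sub>R (\<beta> n :: real ^ 'd)))
        \<le> C * (real N powr (- (S - 1 / 2)) + (1 + real P) powr (- s / 2))"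
      by blast
    let ?V = "{h2_norm M T (\<lambda>t \<omega>. X t \<omega> - (\<Sum>n=1..N. m n t \<omega> *\<^sub>R \<beta> n)) |
           (m :: nat \<Rightarrow> real \<Rightarrow> 'a \<Rightarrow> real) (\<beta> :: nat \<Rightarrow> real ^ 'd).
           \<forall>n\<in>{1..N}. m n \<in> (\<Union>j\<in>{0..P}. chaoslets T W j)}"
    \<comment> \<open>An infimum of reals lies below the members of the set only if the set is
      bounded below; norms are bounded by 0.\<close>
    have "bdd_below ?V" by (rule bdd_belowI[of _ 0]) (auto simp: h2_norm_def)
    moreover have "h2_norm M T (\<lambda>t \<omega>. X t \<omega> - (\<Sum>n=1..N. m n t \<omega> *\<^sub>R \<beta> n)) \<in> ?V" using m by blast
    ultimately have "Inf ?V \<le> h2_norm M T (\<lambda>t \<omega>. X t \<omega> - (\<Sum>n=1..N. m n t \<omega> *\<^sub>R \<beta> n))"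
      by (intro cInf_lower)
    also note bound
    finally show "Inf ?V \<le> C * (real N powr (- (S - 1 / 2)) + (1 + real P) powr (- s / 2))" .
  qed
qed

end
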